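(* Let $C_0$ be the time-zero price of the cliquet option with payoff $H_T=K+K\max\{g,\sum_{k=1}^n\min\{c,R_k\}\}$ at maturity $T$, with local cap $c\ge0$, guaranteed rate at maturity $g$, notional $K$, risk-less interest rate $r$ and $n\in\mathbb N$, and let $Z_k=\min\{c,R_k\}-g/n$. Then the Vega $V:=\partial C_0/\partial\sigma$ has the representation $$V=n\tau\sigma Ke^{-rT-\lambda\tau}\sum_{m=0}^\infty\frac{(\lambda\tau)^m}{m!}\int_{0^+}^{1+c}\Psi(w)\Big[\frac12-\frac1\pi\int_{0^+}^\infty\frac{\mathrm{Re}\big(i\,e^{ix[w-1-g/n]}\phi_{Z_1}(x)^{n-1}\big)}{x}\,dx\Big]\,dw,$$ where $$\Psi(w):=\varphi_{0,1}\Big(\frac{\ln(w)-\gamma\tau-m\mu}{\sqrt{\sigma^2\tau+m\delta^2}}\Big)\frac{\ln(w)-\gamma\tau-m\mu}{\sqrt{(\sigma^2\tau+m\delta^2)^3}}$$ and $\phi_{Z_1}$ is the characteristic function of $Z_1$ under $\mathbb Q$, given by $$\phi_{Z_1}(x)=e^{-ix(1+g/n)}\Big(e^{ix(1+c)}-ixe^{-\lambda\tau}\sum_{m=0}^\infty\frac{(\lambda\tau)^m}{m!}\int_{0^+}^{1+c}e^{ixw}\,\Phi\Big(\frac{\ln(w)-\gamma\tau-m\mu}{\sqrt{\sigma^2\tau+m\delta^2}}\Big)\,dw\Big).$$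
   Context: Under the risk-neutral measure $\mathbb Q$ the stock price is $S_t=S_0e^{X_t}$, $t\in[0,T]$, with $X_t=\gamma t+\sigma W_t+\sum_{j=1}^{N_t}Y_j$, where $W$ is a standard Brownian motion, $N_t$ a Poisson process with intensity $\lambda>0$, and the $Y_j$ are i.i.d. normal with mean $\mu$ and variance $\delta^2$, all independent under $\mathbb Q$; $\sigma>0$ is the volatility parameter and $\gamma:=\eta-\sigma^2/2$, where the drift restriction (discounted stock price is a $\mathbb Q$-martingale) is $\eta=r-\lambda\,\mathbb E_{\mathbb Q}[e^{Y_1}-1]$, with $r>0$. Resetting times: $0<t_0<t_1<\dots<t_n\le T$, equidistant with $\tau=t_k-t_{k-1}$. Returns: $R_k=S_{t_k}/S_{t_{k-1}}-1=e^{X_{t_k}-X_{t_{k-1}}}-1$. The price is $C_0=e^{-rT}\,\mathbb E_{\mathbb Q}[H_T]$. $\Phi$ is the standard normal distribution function and $\varphi_{0,1}=\Phi'$ its density; $\Psi$ depends on the summation index $m$.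
   Formalization: The Vega ∂C_0/∂σ is taken with the log-drift γ held fixed at its risk-neutral value η−σ²/2; if γ varies with σ as defined, the displayed formula is false (e.g. n=1, g=−1, large c), since Ψ lacks a term. *)

theory Defs
  imports "HOL-Probability.Probability"
begin

text \<open>All processes live on the time horizon \<open>{0..T}\<close>.\<close>

definition std_brownian_motion :: "'a measure \<Rightarrow> real \<Rightarrow> (real \<Rightarrow> 'a \<Rightarrow> real) \<Rightarrow> bool" where
  "std_brownian_motion M T W \<longleftrightarrow>
     (\<forall>t\<in>{0..T}. W t \<in> borel_measurable M) \<and>
     (AE \<omega> in M. W 0 \<omega> = 0) \<and>
     (\<forall>s t. 0 \<le> s \<longrightarrow> s < t \<longrightarrow> t \<le> T \<longrightarrow>
        distributed M lborel (\<lambda>\<omega>. W t \<omega> - W s \<omega>) (normal_density 0 (sqrt (t - s)))) \<and>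
     (\<forall>(u :: nat \<Rightarrow> real) n. 0 \<le> u 0 \<longrightarrow> (\<forall>i<n. u i \<le> u (Suc i)) \<longrightarrow> u n \<le> T \<longrightarrow>
        prob_space.indep_vars M (\<lambda>_. borel) (\<lambda>i \<omega>. W (u (Suc i)) \<omega> - W (u i) \<omega>) {..<n}) \<and>
     (AE \<omega> in M. continuous_on {0..T} (\<lambda>t. W t \<omega>))"

text \<open>The truncated subtraction on \<^typ>\<open>nat\<close> is harmless because the paths are nondecreasing
  almost surely.\<close>

definition poisson_process ::
  "'a measure \<Rightarrow> real \<Rightarrow> real \<Rightarrow> (real \<Rightarrow> 'a \<Rightarrow> nat) \<Rightarrow> bool" where
  "poisson_process M T lam N \<longleftrightarrow>
     (\<forall>t\<in>{0..T}. N t \<in> measurable M (count_space UNIV)) \<and>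
     (AE \<omega> in M. N 0 \<omega> = 0) \<and>
     (\<forall>s t. 0 \<le> s \<longrightarrow> s < t \<longrightarrow> t \<le> T \<longrightarrow>
        distr M (count_space UNIV) (\<lambda>\<omega>. N t \<omega> - N s \<omega>)
          = measure_pmf (poisson_pmf (lam * (t - s)))) \<and>
     (\<forall>(u :: nat \<Rightarrow> real) n. 0 \<le> u 0 \<longrightarrow> (\<forall>i<n. u i \<le> u (Suc i)) \<longrightarrow> u n \<le> T \<longrightarrow>
        prob_space.indep_vars M (\<lambda>_. count_space UNIV)
          (\<lambda>i \<omega>. N (u (Suc i)) \<omega> - N (u i) \<omega>) {..<n}) \<and>
     (AE \<omega> in M. mono_on {0..T} (\<lambda>t. N t \<omega>) \<and>
        (\<forall>t\<in>{0..<T}. continuous (at_right t) (\<lambda>s. N s \<omega>)))"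

definition process_sigma ::
  "'a measure \<Rightarrow> 'b measure \<Rightarrow> 'i set \<Rightarrow> ('i \<Rightarrow> 'a \<Rightarrow> 'b) \<Rightarrow> 'a set set" where
  "process_sigma M B I X =
     sigma_sets (space M) (\<Union>i\<in>I. {X i -` A \<inter> space M | A. A \<in> sets B})"

datatype driver = Brownian | Jump_times | Jump_size nat

fun driver_sigma ::
  "'a measure \<Rightarrow> real \<Rightarrow> (real \<Rightarrow> 'a \<Rightarrow> real) \<Rightarrow> (real \<Rightarrow> 'a \<Rightarrow> nat) \<Rightarrow> (nat \<Rightarrow> 'a \<Rightarrow> real) \<Rightarrow>
   driver \<Rightarrow> 'a set set" where
  "driver_sigma M T W N Y Brownian = process_sigma M borel {0..T} W"
| "driver_sigma M T W N Y Jump_times = process_sigma M (count_space UNIV) {0..T} N"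
| "driver_sigma M T W N Y (Jump_size j) = process_sigma M borel {j} Y"

text \<open>Joint independence of the process \<open>W\<close>, the process \<open>N\<close> and all the jump sizes \<open>Y 1, Y 2, \<dots>\<close>;
  in particular the jump sizes are independent of each other.\<close>

definition independent_drivers ::
  "'a measure \<Rightarrow> real \<Rightarrow> (real \<Rightarrow> 'a \<Rightarrow> real) \<Rightarrow> (real \<Rightarrow> 'a \<Rightarrow> nat) \<Rightarrow> (nat \<Rightarrow> 'a \<Rightarrow> real) \<Rightarrow> bool" where
  "independent_drivers M T W N Y \<longleftrightarrow>
     prob_space.indep_sets M (driver_sigma M T W N Y)
       ({Brownian, Jump_times} \<union> Jump_size ` {1..})"

text \<open>The drift \<open>\<gamma>\<close> and the volatility \<open>\<sigma>\<close> are separate arguments of the jump-diffusion and of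
  everything derived from it, so that \<open>\<partial>/\<partial>\<sigma>\<close> below is the partial derivative with the
  drift \<open>\<gamma>\<close> of the log-price held fixed.  If \<open>\<gamma> = \<eta> - \<sigma>\<^sup>2/2\<close> were differentiated
  along, \<open>cliquet_Psi\<close> would acquire the additional summand
  \<open>- \<phi>(\<dots>) / sqrt (\<sigma>\<^sup>2\<tau> + m\<delta>\<^sup>2)\<close>.\<close>

definition jump_diffusion ::
  "(real \<Rightarrow> 'a \<Rightarrow> real) \<Rightarrow> (real \<Rightarrow> 'a \<Rightarrow> nat) \<Rightarrow> (nat \<Rightarrow> 'a \<Rightarrow> real) \<Rightarrow> real \<Rightarrow> real \<Rightarrow>
   real \<Rightarrow> 'a \<Rightarrow> real" where
  "jump_diffusion W N Y \<gamma> \<sigma> u \<omega> = \<gamma> * u + \<sigma> * W u \<omega> + (\<Sum>j=1..N u \<omega>. Y j \<omega>)"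

definition stock_price ::
  "(real \<Rightarrow> 'a \<Rightarrow> real) \<Rightarrow> (real \<Rightarrow> 'a \<Rightarrow> nat) \<Rightarrow> (nat \<Rightarrow> 'a \<Rightarrow> real) \<Rightarrow> real \<Rightarrow> real \<Rightarrow> real \<Rightarrow>
   real \<Rightarrow> 'a \<Rightarrow> real" where
  "stock_price W N Y S0 \<gamma> \<sigma> u \<omega> = S0 * exp (jump_diffusion W N Y \<gamma> \<sigma> u \<omega>)"

definition period_return ::
  "(real \<Rightarrow> 'a \<Rightarrow> real) \<Rightarrow> (real \<Rightarrow> 'a \<Rightarrow> nat) \<Rightarrow> (nat \<Rightarrow> 'a \<Rightarrow> real) \<Rightarrow> real \<Rightarrow> real \<Rightarrow> real \<Rightarrow>
   (nat \<Rightarrow> real) \<Rightarrow> nat \<Rightarrow> 'a \<Rightarrow> real" where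
  "period_return W N Y S0 \<gamma> \<sigma> t k \<omega> =
     stock_price W N Y S0 \<gamma> \<sigma> (t k) \<omega> / stock_price W N Y S0 \<gamma> \<sigma> (t (k - 1)) \<omega> - 1"

definition cliquet_payoff ::
  "(real \<Rightarrow> 'a \<Rightarrow> real) \<Rightarrow> (real \<Rightarrow> 'a \<Rightarrow> nat) \<Rightarrow> (nat \<Rightarrow> 'a \<Rightarrow> real) \<Rightarrow> real \<Rightarrow> real \<Rightarrow> real \<Rightarrow>
   (nat \<Rightarrow> real) \<Rightarrow> nat \<Rightarrow> real \<Rightarrow> real \<Rightarrow> real \<Rightarrow> 'a \<Rightarrow> real" where
  "cliquet_payoff W N Y S0 \<gamma> \<sigma> t n K g c \<omega> =
     K + K * max g (\<Sum>k=1..n. min c (period_return W N Y S0 \<gamma> \<sigma> t k \<omega>))"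

definition cliquet_price ::
  "'a measure \<Rightarrow> (real \<Rightarrow> 'a \<Rightarrow> real) \<Rightarrow> (real \<Rightarrow> 'a \<Rightarrow> nat) \<Rightarrow> (nat \<Rightarrow> 'a \<Rightarrow> real) \<Rightarrow>
   real \<Rightarrow> real \<Rightarrow> real \<Rightarrow> real \<Rightarrow> real \<Rightarrow> (nat \<Rightarrow> real) \<Rightarrow> nat \<Rightarrow> real \<Rightarrow> real \<Rightarrow> real \<Rightarrow> real" where
  "cliquet_price M W N Y S0 r T \<gamma> \<sigma> t n K g c =
     exp (- r * T) * (LINT \<omega>|M. cliquet_payoff W N Y S0 \<gamma> \<sigma> t n K g c \<omega>)"

definition cliquet_Z ::
  "(real \<Rightarrow> 'a \<Rightarrow> real) \<Rightarrow> (real \<Rightarrow> 'a \<Rightarrow> nat) \<Rightarrow> (nat \<Rightarrow> 'a \<Rightarrow> real) \<Rightarrow> real \<Rightarrow> real \<Rightarrow> real \<Rightarrow>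
   (nat \<Rightarrow> real) \<Rightarrow> nat \<Rightarrow> real \<Rightarrow> real \<Rightarrow> nat \<Rightarrow> 'a \<Rightarrow> real" where
  "cliquet_Z W N Y S0 \<gamma> \<sigma> t n g c k \<omega> = min c (period_return W N Y S0 \<gamma> \<sigma> t k \<omega>) - g / real n"

definition std_arg ::
  "real \<Rightarrow> real \<Rightarrow> real \<Rightarrow> real \<Rightarrow> real \<Rightarrow> nat \<Rightarrow> real \<Rightarrow> real" where
  "std_arg \<tau> \<gamma> \<sigma> \<mu> \<delta> m w =
     (ln w - \<gamma> * \<tau> - real m * \<mu>) / sqrt (\<sigma>\<^sup>2 * \<tau> + real m * \<delta>\<^sup>2)"

definition cliquet_Psi ::
  "real \<Rightarrow> real \<Rightarrow> real \<Rightarrow> real \<Rightarrow> real \<Rightarrow> nat \<Rightarrow> real \<Rightarrow> real" where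
  "cliquet_Psi \<tau> \<gamma> \<sigma> \<mu> \<delta> m w =
     std_normal_density (std_arg \<tau> \<gamma> \<sigma> \<mu> \<delta> m w) *
     ((ln w - \<gamma> * \<tau> - real m * \<mu>) / sqrt ((\<sigma>\<^sup>2 * \<tau> + real m * \<delta>\<^sup>2) ^ 3))"

text \<open>The integrand of the inner integral over \<open>(0, \<infinity>)\<close>.  That integral converges only
  conditionally in general (for \<open>n = 1\<close> it is a Dirichlet integral), hence it is taken as a
  gauge integral rather than as a Lebesgue integral.\<close>

definition inversion_integrand :: "(real \<Rightarrow> complex) \<Rightarrow> nat \<Rightarrow> real \<Rightarrow> real \<Rightarrow> real \<Rightarrow> real" where
  "inversion_integrand \<phi>Z n g w x =
     Re (\<i> * iexp (x * (w - 1 - g / real n)) * \<phi>Z x ^ (n - 1)) / x"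

end

theory Submission
  imports Defs
begin

text \<open>Up to the factor \<open>K * exp (- r * T)\<close> and an additive constant, the price is the expectation of
  \<open>max 0 (a + (\<Sum>i<n. U i))\<close>, where \<open>U i = min (1 + c) (exp X\<^sub>i)\<close> are the capped growth factors of the
  periods.  For independent \<open>U\<close> and \<open>B\<close> the layer-cake formula expresses the expectation of
  \<open>max 0 (B + U)\<close> through \<open>\<integral> P (U \<le> w) * P (0 < B + w) dw\<close>, so only the
  distribution function of \<open>U\<close> has to be differentiated in the volatility.  Changing the volatility in
  one period after the other makes the difference quotient of the price a telescoping sum of \<open>n\<close> such
  terms, and dominated convergence gives the limit, because \<open>P (B + w = 0) > 0\<close> for countably
  many \<open>w\<close> only.  The Gil-Pelaez formula turns \<open>P (0 < B + w)\<close> into the inversion integral.\<close>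

section \<open>The distribution function of a log-return\<close>

text \<open>The hidden obstacle is the independence of the log-returns: the jump sizes entering a
  period carry random indices, and one counting process selects them for all periods. The counts at
  the resetting times are therefore frozen; given their values the periods use disjoint blocks of
  \<open>Y\<close>, and summing over the countably many values yields a product law. The kink of the
  payoff is never differentiated. The distribution function of one period is a Poisson mixture of
  normal ones, whose derivative in the volatility is bounded away from volatility zero; this bound
  dominates the difference quotients. The other periods contribute only through continuity along
  each path, available because the same drivers serve every volatility. The cap makes all variables
  bounded, so Fubini applies on finite ranges, and the atom it creates at \<open>1 + c\<close>
  touches only the end point of the range of \<open>w\<close>. Inversion produces P (0 < X) + P (X =
  0) / 2 rather than P (0 < X); under the integral over \<open>w\<close> the difference
  vanishes.\<close>

lemma std_normal_distribution_cdf_has_derivative [derivative_intros]: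
  "(cdf std_normal_distribution has_real_derivative std_normal_density x) (at x)"
proof -
  interpret real_distribution std_normal_distribution
    by (rule real_dist_normal_dist)
  have cont: "continuous_on A std_normal_density" for A
    by (auto simp: normal_density_def[abs_def] intro!: continuous_intros)
  \<comment> \<open>The base point \<open>x - 1\<close> replaces minus infinity, so that the
    fundamental theorem on a compact interval applies; it lies left of \<open>x\<close>, hence the
    formula holds near \<open>x\<close>.\<close>
  have diff: "cdf std_normal_distribution y = cdf std_normal_distribution (x - 1) +
      integral {x - 1..y} std_normal_density" if "x - 1 \<le> y" for y
  proof -
    have "emeasure std_normal_distribution {x - 1..y} = ennreal (integral {x - 1..y} std_normal_density)"
    proof -
      have "(\<integral>\<^sup>+z. ennreal (indicator {x - 1..y} z * std_normal_density z) \<partial>lborel) =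
          ennreal (integral {x - 1..y} std_normal_density)"
        by (intro nn_integral_has_integral_lebesgue integrable_integral
            integrable_continuous_interval cont) auto
      then show ?thesis
        by (simp add: emeasure_density ennreal_mult' ennreal_indicator mult.commute)
    qed
    moreover have "measure std_normal_distribution {x - 1} = 0"
      by (simp add: measure_def emeasure_density nn_integral_null_set)
    moreover have "integral {x - 1..y} std_normal_density \<ge> 0"
      by (intro integral_nonneg integrable_continuous_interval cont) auto
    moreover have "{..y} = {..x - 1} \<union> {x - 1<..y}"
      using that by auto
    then have "measure std_normal_distribution {..y} =
        measure std_normal_distribution {..x - 1} + measure std_normal_distribution {x - 1<..y}"
      by (rule ssubst[where P="\<lambda>A. measure _ A = _"]) (rule finite_measure_Union, auto)
    moreover have "{x - 1..y} = {x - 1} \<union> {x - 1<..y}"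
      using that by auto
    then have "measure std_normal_distribution {x - 1..y} =
        measure std_normal_distribution {x - 1} + measure std_normal_distribution {x - 1<..y}"
      by (rule ssubst[where P="\<lambda>A. measure _ A = _"]) (rule finite_measure_Union, auto)
    ultimately show ?thesis
      by (simp add: cdf_def measure_def)
  qed
  have "((\<lambda>y. integral {x - 1..y} std_normal_density) has_real_derivative std_normal_density x)
      (at x within {x - 1..x + 1})"
    by (intro integral_has_real_derivative cont) auto
  moreover have "at x within {x - 1..x + 1} = at x"
    by (intro at_within_interior) auto
  ultimately have "((\<lambda>y. cdf std_normal_distribution (x - 1) + integral {x - 1..y} std_normal_density)
      has_real_derivative std_normal_density x) (at x)"
    by (auto intro!: derivative_eq_intros)
  moreover have "eventually (\<lambda>y. y \<in> {x - 1<..}) (nhds x)"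
    by (intro eventually_nhds_in_open) auto
  then have "eventually (\<lambda>y. cdf std_normal_distribution (x - 1) + integral {x - 1..y} std_normal_density =
      cdf std_normal_distribution y) (nhds x)"
    by eventually_elim (rule diff[symmetric], simp)
  ultimately show ?thesis
    using DERIV_cong_ev[OF refl _ refl] by fast
qed

text \<open>Gaussian decay absorbs the linear factor, by |x| <= 1 + x^2 / 2 <= exp (x^2 / 2). The
  value 1 is not sharp; what matters is that it is free of \<open>x\<close>.\<close>

lemma std_normal_density_times_le_1: "\<bar>std_normal_density x * x\<bar> \<le> 1"
proof -
  have "\<bar>x\<bar> \<le> 1 + x\<^sup>2 / 2"
    using zero_le_power2[of "\<bar>x\<bar> - 1"] by (simp add: power2_diff)
  also have "\<dots> \<le> exp (x\<^sup>2 / 2)"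
    by (rule exp_ge_add_one_self)
  finally have "\<bar>x\<bar> * exp (- (x\<^sup>2 / 2)) \<le> 1"
    by (simp add: exp_minus field_simps)
  moreover have "1 / sqrt (2 * pi) \<le> 1"
    using pi_gt3 by (simp add: real_le_rsqrt)
  ultimately have "1 / sqrt (2 * pi) * (\<bar>x\<bar> * exp (- (x\<^sup>2 / 2))) \<le> 1 * 1"
    by (intro mult_mono) auto
  then show ?thesis
    by (simp add: std_normal_density_def abs_mult mult_ac)
qed

lemma std_variance_pos:
  fixes s \<tau> \<delta> :: real
  assumes "s > 0" "\<tau> > 0"
  shows "s\<^sup>2 * \<tau> + real m * \<delta>\<^sup>2 > 0"
  using assms by (intro add_pos_nonneg) auto

text \<open>The volatility enters the argument z only through the variance v =
  \<open>s\<^sup>2 * \<tau> + m * \<delta>\<^sup>2\<close>, so z' = - z s \<tau> / v; this is the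
  origin of the power 3/2 of v in \<open>cliquet_Psi\<close>.\<close>

lemma cdf_std_arg_has_derivative:
  fixes s :: real
  assumes "s > 0" "\<tau> > 0"
  shows "((\<lambda>s. cdf std_normal_distribution (std_arg \<tau> \<gamma> s \<mu> \<delta> m w)) has_real_derivative
    - (s * \<tau> * cliquet_Psi \<tau> \<gamma> s \<mu> \<delta> m w)) (at s)"
proof -
  define v where "v = s\<^sup>2 * \<tau> + real m * \<delta>\<^sup>2"
  have v: "v > 0"
    unfolding v_def by (rule std_variance_pos[OF assms])
  have "sqrt (v ^ 3) = v * sqrt v"
    using v by (simp add: power3_eq_cube real_sqrt_mult)
  then have "s * \<tau> * cliquet_Psi \<tau> \<gamma> s \<mu> \<delta> m w =
      std_normal_density (std_arg \<tau> \<gamma> s \<mu> \<delta> m w) *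
      ((ln w - \<gamma> * \<tau> - real m * \<mu>) * (s * \<tau>) / (v * sqrt v))"
    by (simp add: cliquet_Psi_def v_def[symmetric])
  moreover have "((\<lambda>s. std_arg \<tau> \<gamma> s \<mu> \<delta> m w) has_real_derivative
      - ((ln w - \<gamma> * \<tau> - real m * \<mu>) * (s * \<tau>) / (v * sqrt v))) (at s)"
    unfolding std_arg_def using v
    by (auto intro!: derivative_eq_intros simp: v_def[symmetric])
      (simp add: field_simps)
  ultimately show ?thesis
    using DERIV_chain2[OF std_normal_distribution_cdf_has_derivative] by fastforce
qed

text \<open>With z the standardised argument and v the variance, \<open>cliquet_Psi\<close> is z
  times the normal density at z, divided by v. The smallest variance is that of
  \<open>m = 0\<close>, which gives a bound uniform in \<open>m\<close> and
  \<open>w\<close>.\<close>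

lemma cliquet_Psi_bound:
  assumes "s > 0" "\<tau> > 0"
  shows "\<bar>cliquet_Psi \<tau> \<gamma> s \<mu> \<delta> m w\<bar> \<le> 1 / (s\<^sup>2 * \<tau>)"
proof -
  define v where "v = s\<^sup>2 * \<tau> + real m * \<delta>\<^sup>2"
  have v: "v > 0"
    unfolding v_def by (rule std_variance_pos[OF assms])
  have "sqrt (v ^ 3) = v * sqrt v"
    using v by (simp add: power3_eq_cube real_sqrt_mult)
  then have "cliquet_Psi \<tau> \<gamma> s \<mu> \<delta> m w =
      (std_normal_density (std_arg \<tau> \<gamma> s \<mu> \<delta> m w) * std_arg \<tau> \<gamma> s \<mu> \<delta> m w) / v"
    by (simp add: cliquet_Psi_def std_arg_def v_def[symmetric])
  then have "\<bar>cliquet_Psi \<tau> \<gamma> s \<mu> \<delta> m w\<bar> \<le> 1 / v"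
    using std_normal_density_times_le_1[of "std_arg \<tau> \<gamma> s \<mu> \<delta> m w"] v
    by (simp add: divide_right_mono)
  also have "\<dots> \<le> 1 / (s\<^sup>2 * \<tau>)"
    using assms v by (intro divide_left_mono mult_pos_pos) (auto simp: v_def)
  finally show ?thesis .
qed

lemma measurable_cdf_std_normal [measurable]:
  "cdf std_normal_distribution \<in> borel_measurable borel"
  by (intro borel_measurable_continuous_onI continuous_at_imp_continuous_on ballI
      DERIV_isCont[OF std_normal_distribution_cdf_has_derivative])

lemma measurable_std_arg [measurable]: "std_arg \<tau> \<gamma> s \<mu> \<delta> m \<in> borel_measurable borel"
  unfolding std_arg_def[abs_def] by measurable

lemma measurable_cliquet_Psi [measurable]: "cliquet_Psi \<tau> \<gamma> s \<mu> \<delta> m \<in> borel_measurable borel"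
  unfolding cliquet_Psi_def[abs_def] by measurable

lemma cdf_std_normal_bounds:
  "0 \<le> cdf std_normal_distribution x" "cdf std_normal_distribution x \<le> 1"
proof -
  interpret real_distribution std_normal_distribution
    by (rule real_dist_normal_dist)
  show "0 \<le> cdf std_normal_distribution x" "cdf std_normal_distribution x \<le> 1"
    by (auto simp: cdf_nonneg cdf_bounded_prob)
qed

section \<open>Poisson mixtures of normal distribution functions\<close>

lemma poisson_weights:
  fixes a :: real
  assumes "a \<ge> 0"
  shows "summable (\<lambda>m. a ^ m / fact m)" "\<And>m. a ^ m / fact m \<ge> 0"
    "(\<Sum>m. a ^ m / fact m) = exp a"
  using summable_exp_generic[of a] assms by (auto simp: exp_def divide_inverse mult_ac)

text \<open>Given \<open>m\<close> jumps in a period the log-return is normal; averaging over the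
  Poisson number of jumps gives the distribution function of the growth factor, as
  \<open>log_incr_cdf\<close> confirms for positive \<open>w\<close>.\<close>

definition jump_diffusion_cdf ::
  "real \<Rightarrow> real \<Rightarrow> real \<Rightarrow> real \<Rightarrow> real \<Rightarrow> real \<Rightarrow> real \<Rightarrow> real" where
  "jump_diffusion_cdf lam \<tau> \<gamma> \<mu> \<delta> s w = exp (- lam * \<tau>) *
     (\<Sum>m. (lam * \<tau>) ^ m / fact m * cdf std_normal_distribution (std_arg \<tau> \<gamma> s \<mu> \<delta> m w))"

definition jump_diffusion_cdf_deriv ::
  "real \<Rightarrow> real \<Rightarrow> real \<Rightarrow> real \<Rightarrow> real \<Rightarrow> real \<Rightarrow> real \<Rightarrow> real" where
  "jump_diffusion_cdf_deriv lam \<tau> \<gamma> \<mu> \<delta> s w = exp (- lam * \<tau>) *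
     (\<Sum>m. (lam * \<tau>) ^ m / fact m * - (s * \<tau> * cliquet_Psi \<tau> \<gamma> s \<mu> \<delta> m w))"

text \<open>Stated over a normed algebra in order to serve both the real series of the price and the
  complex series of the characteristic function.\<close>

lemma summable_weighted:
  fixes p :: "nat \<Rightarrow> real" and f :: "nat \<Rightarrow> 'b::{real_normed_algebra_1,banach}"
  assumes "summable p" "\<And>m. p m \<ge> 0" "\<And>m. norm (f m) \<le> C"
  shows "summable (\<lambda>m. of_real (p m) * f m)"
proof (rule summable_comparison_test')
  show "summable (\<lambda>m. p m * C)"
    using assms by (intro summable_mult2)
  show "norm (of_real (p m) * f m) \<le> p m * C" for m
    using assms by (auto intro!: order_trans[OF norm_mult_ineq] mult_left_mono)
qed

lemma vega_term_bound:
  assumes "s > 0" "\<tau> > 0"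
  shows "\<bar>s * \<tau> * cliquet_Psi \<tau> \<gamma> s \<mu> \<delta> m w\<bar> \<le> 1 / s"
proof -
  have "\<bar>s * \<tau> * cliquet_Psi \<tau> \<gamma> s \<mu> \<delta> m w\<bar> \<le> s * \<tau> * (1 / (s\<^sup>2 * \<tau>))"
    using cliquet_Psi_bound[OF assms, of \<gamma> \<mu> \<delta> m w] assms
    by (simp add: abs_mult del: times_divide_eq_right)
  also have "\<dots> = 1 / s"
    using assms by (simp add: power2_eq_square)
  finally show ?thesis .
qed

lemma jump_diffusion_cdf_has_derivative:
  assumes "s > 0" "\<tau> > 0" "lam \<ge> 0"
  shows "((\<lambda>s. jump_diffusion_cdf lam \<tau> \<gamma> \<mu> \<delta> s w) has_real_derivative
    jump_diffusion_cdf_deriv lam \<tau> \<gamma> \<mu> \<delta> s w) (at s)"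
proof -
  \<comment> \<open>The bound \<open>1 / x\<close> on the derivatives of the terms blows up at
    volatility zero; cutting at \<open>s / 2\<close> keeps it below \<open>2 / s\<close> and leaves
    \<open>s\<close> in the interior.\<close>
  let ?S = "{s / 2<..}"
  let ?p = "\<lambda>m. (lam * \<tau>) ^ m / fact m"
  note p = poisson_weights[of "lam * \<tau>"]
  have "uniformly_convergent_on ?S (\<lambda>n x. \<Sum>m<n. ?p m * - (x * \<tau> * cliquet_Psi \<tau> \<gamma> x \<mu> \<delta> m w))"
  proof (rule Weierstrass_m_test')
    show "norm (?p m * - (x * \<tau> * cliquet_Psi \<tau> \<gamma> x \<mu> \<delta> m w)) \<le> ?p m * (2 / s)" if "x \<in> ?S" for m x
    proof -
      have "\<bar>x * \<tau> * cliquet_Psi \<tau> \<gamma> x \<mu> \<delta> m w\<bar> \<le> 1 / x"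
        using that assms by (intro vega_term_bound) auto
      also have "\<dots> \<le> 2 / s"
        using that assms by (simp add: field_simps)
      finally show ?thesis
        using p(2)[of m] assms unfolding real_norm_def abs_mult abs_minus_cancel
        by (intro mult_mono) (auto simp del: abs_mult)
    qed
    show "summable (\<lambda>m. ?p m * (2 / s))"
      using p(1) assms by (intro summable_mult2) auto
  qed
  moreover have "((\<lambda>s. ?p m * cdf std_normal_distribution (std_arg \<tau> \<gamma> s \<mu> \<delta> m w)) has_real_derivative
      ?p m * - (x * \<tau> * cliquet_Psi \<tau> \<gamma> x \<mu> \<delta> m w)) (at x within ?S)" if "x \<in> ?S" for x m
    using that assms
    by (intro DERIV_cmult has_field_derivative_at_within[OF cdf_std_arg_has_derivative]) auto
  moreover have "summable (\<lambda>m. ?p m * cdf std_normal_distribution (std_arg \<tau> \<gamma> s \<mu> \<delta> m w))"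
    using summable_weighted[of ?p "\<lambda>m. cdf std_normal_distribution (std_arg \<tau> \<gamma> s \<mu> \<delta> m w)" 1]
      p cdf_std_normal_bounds assms by simp
  ultimately have "((\<lambda>s. \<Sum>m. ?p m * cdf std_normal_distribution (std_arg \<tau> \<gamma> s \<mu> \<delta> m w))
      has_real_derivative (\<Sum>m. ?p m * - (s * \<tau> * cliquet_Psi \<tau> \<gamma> s \<mu> \<delta> m w))) (at s)"
    using assms by (intro has_field_derivative_series'(2)[of ?S _ _ s]) (auto simp: interior_open)
  then show ?thesis
    unfolding jump_diffusion_cdf_def jump_diffusion_cdf_deriv_def by (rule DERIV_cmult)
qed

lemma jump_diffusion_cdf_deriv_bound:
  assumes "s > 0" "\<tau> > 0" "lam \<ge> 0"
  shows "\<bar>jump_diffusion_cdf_deriv lam \<tau> \<gamma> \<mu> \<delta> s w\<bar> \<le> 1 / s"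
proof -
  let ?p = "\<lambda>m. (lam * \<tau>) ^ m / fact m"
  let ?f = "\<lambda>m. - (s * \<tau> * cliquet_Psi \<tau> \<gamma> s \<mu> \<delta> m w)"
  note p = poisson_weights[of "lam * \<tau>"]
  have le: "\<bar>?p m * ?f m\<bar> \<le> ?p m * (1 / s)" for m
    using vega_term_bound[OF assms(1,2), of \<gamma> \<mu> \<delta> m w] p(2)[of m] assms
    unfolding abs_mult abs_minus_cancel by (intro mult_mono) auto
  have "\<bar>\<Sum>m. ?p m * ?f m\<bar> \<le> (\<Sum>m. ?p m * (1 / s))"
  proof (rule order_trans[OF summable_rabs suminf_le])
    show s: "summable (\<lambda>m. ?p m * (1 / s))"
      using p assms by (intro summable_mult2) auto
    show "summable (\<lambda>m. \<bar>?p m * ?f m\<bar>)"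
      by (rule summable_comparison_test'[OF s, of 0]) (use le in auto)
    then show "summable (\<lambda>m. \<bar>?p m * ?f m\<bar>)" .
  qed (use le in auto)
  also have "\<dots> = exp (lam * \<tau>) * (1 / s)"
    using p assms by (subst suminf_mult2[symmetric]) auto
  finally have "exp (- lam * \<tau>) * \<bar>\<Sum>m. ?p m * ?f m\<bar> \<le> exp (- lam * \<tau>) * (exp (lam * \<tau>) * (1 / s))"
    by (intro mult_left_mono) auto
  also have "\<dots> = 1 / s"
    by (simp add: exp_minus)
  finally show ?thesis
    by (simp add: jump_diffusion_cdf_deriv_def abs_mult)
qed

text \<open>Mean value inequality on the convex half-line above \<open>s / 2\<close>. It provides
  the constant that dominates the difference quotients of the price.\<close>

lemma jump_diffusion_cdf_quotient_bound:
  assumes "s > 0" "x > s / 2" "\<tau> > 0" "lam \<ge> 0"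
  shows "\<bar>jump_diffusion_cdf lam \<tau> \<gamma> \<mu> \<delta> x w - jump_diffusion_cdf lam \<tau> \<gamma> \<mu> \<delta> s w\<bar> \<le>
    2 / s * \<bar>x - s\<bar>"
proof -
  have "norm (jump_diffusion_cdf lam \<tau> \<gamma> \<mu> \<delta> x w - jump_diffusion_cdf lam \<tau> \<gamma> \<mu> \<delta> s w) \<le>
    2 / s * norm (x - s)"
  proof (rule field_differentiable_bound[of "{s / 2<..}"])
    show "((\<lambda>s. jump_diffusion_cdf lam \<tau> \<gamma> \<mu> \<delta> s w) has_field_derivative
      jump_diffusion_cdf_deriv lam \<tau> \<gamma> \<mu> \<delta> y w) (at y within {s / 2<..})" if "y \<in> {s / 2<..}" for y
      using that assms
      by (intro has_field_derivative_at_within[OF jump_diffusion_cdf_has_derivative]) auto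
    show "norm (jump_diffusion_cdf_deriv lam \<tau> \<gamma> \<mu> \<delta> y w) \<le> 2 / s" if "y \<in> {s / 2<..}" for y
    proof -
      have "norm (jump_diffusion_cdf_deriv lam \<tau> \<gamma> \<mu> \<delta> y w) \<le> 1 / y"
        using that assms jump_diffusion_cdf_deriv_bound[of y \<tau> lam] by auto
      also have "\<dots> \<le> 2 / s"
        using that assms by (simp add: field_simps)
      finally show ?thesis .
    qed
  qed (use assms in auto)
  then show ?thesis by simp
qed

lemma measurable_jump_diffusion_cdf [measurable]:
  "jump_diffusion_cdf lam \<tau> \<gamma> \<mu> \<delta> s \<in> borel_measurable borel"
  unfolding jump_diffusion_cdf_def[abs_def] by measurable

lemma measurable_jump_diffusion_cdf_deriv [measurable]:
  "jump_diffusion_cdf_deriv lam \<tau> \<gamma> \<mu> \<delta> s \<in> borel_measurable borel"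
  unfolding jump_diffusion_cdf_deriv_def[abs_def] by measurable

section \<open>Gil-Pelaez inversion for bounded random variables\<close>

text \<open>Integrating \<open>sin (x * X) / x\<close> first in \<open>x\<close> over \<open>{0..b}\<close> gives \<open>sgn X * Si (b * \<bar>X\<bar>)\<close>,
  which is bounded uniformly in \<open>b\<close>.\<close>

lemma (in prob_space) gil_pelaez_bounded:
  fixes X :: "'a \<Rightarrow> real"
  assumes [measurable]: "random_variable borel X"
    and bound: "\<And>\<omega>. \<omega> \<in> space M \<Longrightarrow> \<bar>X \<omega>\<bar> \<le> B"
  shows "((\<lambda>x. Im (char (distr M borel X) x) / x) has_integral
    pi / 2 * expectation (\<lambda>\<omega>. sgn (X \<omega>))) {0<..}"
proof -
  define f where "f x = Im (char (distr M borel X) x) / x" for x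
  have f_eq: "f x = expectation (\<lambda>\<omega>. sin (x * X \<omega>) / x)" for x
    unfolding f_def char_def
    by (subst integral_distr) (auto simp: Im_exp integrable_iexp
        simp flip: integral_Im Bochner_Integration.integral_divide_zero)
  \<comment> \<open>The singularity at 0 is removable; at \<open>x = 0\<close> itself division by
    zero yields 0, so the bound covers that point too.\<close>
  have sin_bound: "\<bar>sin (x * y) / x\<bar> \<le> \<bar>y\<bar>" for x y :: real
    using abs_sin_x_le_abs_x[of "x * y"] by (cases "x = 0") (auto simp: abs_mult field_simps)
  have [measurable]: "f \<in> borel_measurable borel"
    unfolding f_eq by measurable
  define J where "J b = expectation (\<lambda>\<omega>. sgn (X \<omega>) * Si (b * \<bar>X \<omega>\<bar>))" for b
  have J: "set_integrable lborel {0<..b} f" "(LBINT x:{0<..b}. f x) = J b" if b: "b \<ge> 0" for b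
  proof -
    interpret P: pair_sigma_finite "lborel :: real measure" M ..
    have int: "integrable (lborel \<Otimes>\<^sub>M M) (\<lambda>(x, \<omega>). indicator {0<..b} x *\<^sub>R (sin (x * X \<omega>) / x))"
    proof (rule Bochner_Integration.integrable_bound)
      show "integrable (lborel \<Otimes>\<^sub>M M) (\<lambda>(x, \<omega>). indicator {0<..b} x * B)"
      proof (intro P.Fubini_integrable)
        have "integrable lborel (\<lambda>x. indicator {0<..b} x * \<bar>B\<bar>)"
          by (intro integrable_mult_left) (simp add: b)
        then show "integrable lborel (\<lambda>x. LINT \<omega>|M. norm (case (x, \<omega>) of (x, \<omega>) \<Rightarrow> indicator {0<..b} x * B))"
          by (simp add: abs_mult prob_space)
        show "AE x in lborel. integrable M (\<lambda>\<omega>. case (x, \<omega>) of (x, \<omega>) \<Rightarrow> indicator {0<..b} x * B)"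
          by (intro AE_I2) simp
      qed simp
      show "AE z in lborel \<Otimes>\<^sub>M M. norm (case z of (x, \<omega>) \<Rightarrow> indicator {0<..b} x *\<^sub>R (sin (x * X \<omega>) / x))
          \<le> norm (case z of (x, \<omega>) \<Rightarrow> indicator {0<..b} x * B)"
      proof (rule AE_I2)
        fix z assume z: "z \<in> space ((lborel :: real measure) \<Otimes>\<^sub>M M)"
        have "\<bar>sin (fst z * X (snd z)) / fst z\<bar> \<le> \<bar>B\<bar>"
          using sin_bound[of "fst z" "X (snd z)"] bound[of "snd z"] z
          by (simp add: space_pair_measure mem_Times_iff)
        then show "norm (case z of (x, \<omega>) \<Rightarrow> indicator {0<..b} x *\<^sub>R (sin (x * X \<omega>) / x))
          \<le> norm (case z of (x, \<omega>) \<Rightarrow> indicator {0<..b} x * B)"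
          by (auto simp: case_prod_unfold indicator_def abs_mult)
      qed
    qed measurable
    show "set_integrable lborel {0<..b} f"
      using P.integrable_fst'[OF int] by (simp add: set_integrable_def f_eq)
    have "(LBINT x:{0<..b}. f x) =
        (\<integral>x. (\<integral>\<omega>. indicator {0<..b} x *\<^sub>R (sin (x * X \<omega>) / x) \<partial>M) \<partial>lborel)"
      by (simp add: set_lebesgue_integral_def f_eq)
    also have "\<dots> = (\<integral>\<omega>. (\<integral>x. indicator {0<..b} x *\<^sub>R (sin (x * X \<omega>) / x) \<partial>lborel) \<partial>M)"
      using P.Fubini_integral[OF int] by simp
    also have "\<dots> = J b"
      unfolding J_def
    proof (intro Bochner_Integration.integral_cong refl)
      fix \<omega>
      have "(\<integral>x. indicator {0<..b} x *\<^sub>R (sin (x * X \<omega>) / x) \<partial>lborel) = (LBINT x=0..b. sin (x * X \<omega>) / x)"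
        using b by (simp add: interval_integral_Ioc' set_lebesgue_integral_def zero_ereal_def
            interval_integral_Ioc indicator_def)
      then show "(\<integral>x. indicator {0<..b} x *\<^sub>R (sin (x * X \<omega>) / x) \<partial>lborel) = sgn (X \<omega>) * Si (b * \<bar>X \<omega>\<bar>)"
        using LBINT_I0c_sin_scale_divide[OF b] by simp
    qed
    finally show "(LBINT x:{0<..b}. f x) = J b" .
  qed
  obtain C where C: "\<And>T. \<bar>Si T\<bar> \<le> C"
    using bounded_Si by auto
  have "(J \<longlongrightarrow> expectation (\<lambda>\<omega>. sgn (X \<omega>) * (pi / 2))) at_top"
    unfolding J_def
  proof (rule integral_dominated_convergence_at_top)
    show "\<forall>\<^sub>F b in at_top. AE \<omega> in M. norm (sgn (X \<omega>) * Si (b * \<bar>X \<omega>\<bar>)) \<le> C"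
      using C order_trans[OF abs_ge_zero C] by (auto simp: abs_mult abs_sgn_eq)
    show "AE \<omega> in M. ((\<lambda>b. sgn (X \<omega>) * Si (b * \<bar>X \<omega>\<bar>)) \<longlongrightarrow> sgn (X \<omega>) * (pi / 2)) at_top"
    proof (intro AE_I2)
      fix \<omega>
      show "((\<lambda>b. sgn (X \<omega>) * Si (b * \<bar>X \<omega>\<bar>)) \<longlongrightarrow> sgn (X \<omega>) * (pi / 2)) at_top"
      \<comment> \<open>At \<open>X \<omega> = 0\<close> both sides vanish because
        \<open>sgn 0 = 0\<close>. This is how an atom at zero comes to be counted with weight one
        half.\<close>
      proof (cases "X \<omega> = 0")
        case False
        then have "filterlim (\<lambda>b. b * \<bar>X \<omega>\<bar>) at_top at_top"
          by (intro filterlim_at_top_mult_tendsto_pos[OF tendsto_const])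
            (auto intro: filterlim_ident)
        then show ?thesis
          by (intro tendsto_mult tendsto_const filterlim_compose[OF Si_at_top])
      qed simp
    qed
  qed auto
  then have lim: "(J \<longlongrightarrow> pi / 2 * expectation (\<lambda>\<omega>. sgn (X \<omega>))) at_top"
    by (simp add: mult.commute)
  \<comment> \<open>Over a set that is not a compact box the gauge integral is defined by exhaustion
    with growing boxes. Ruling out the box case reduces the claim to the improper limit of
    \<open>J\<close>.\<close>
  have not_cbox: "\<not> (\<exists>a b. {0<..} = cbox a (b :: real))"
  proof (intro notI, elim exE)
    fix a b :: real
    assume "{0<..} = cbox a b"
    then have "max 1 (b + 1) \<in> cbox a b"
      by (metis greaterThan_iff less_max_iff_disj zero_less_one)
    then show False by simp
  qed
  show ?thesis
    unfolding f_def[symmetric]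
  proof (subst has_integral_alt, subst if_not_P[OF not_cbox], intro allI impI)
    fix e :: real assume "e > 0"
    with lim have "eventually (\<lambda>b. dist (J b) (pi / 2 * expectation (\<lambda>\<omega>. sgn (X \<omega>))) < e) at_top"
      by (rule tendstoD)
    then obtain b0 where b0: "\<And>b. b \<ge> b0 \<Longrightarrow> dist (J b) (pi / 2 * expectation (\<lambda>\<omega>. sgn (X \<omega>))) < e"
      by (auto simp: eventually_at_top_linorder)
    show "\<exists>B>0. \<forall>a b. ball 0 B \<subseteq> cbox a b \<longrightarrow>
        (\<exists>z. ((\<lambda>x. if x \<in> {0<..} then f x else 0) has_integral z) (cbox a b) \<and>
          norm (z - pi / 2 * expectation (\<lambda>\<omega>. sgn (X \<omega>))) < e)"
    proof (rule exI[of _ "max 1 b0"], intro conjI allI impI)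
      fix a b :: real
      assume sub: "ball 0 (max 1 b0) \<subseteq> cbox a b"
      have ab: "a \<le> 0" "b \<ge> 0"
        using sub by (auto simp: subset_iff dest: spec[of _ 0])
      \<comment> \<open>Otherwise the midpoint of \<open>b\<close> and \<open>b0\<close> lies in the
        ball but to the right of the box.\<close>
      have "b \<ge> b0"
      proof (rule ccontr)
        assume "\<not> b \<ge> b0"
        then have "(b + b0) / 2 \<in> ball 0 (max 1 b0)"
          using ab by (auto simp: dist_real_def)
        then have "(b + b0) / 2 \<in> cbox a b"
          using sub by blast
        with \<open>\<not> b \<ge> b0\<close> show False
          by simp
      qed
      have "(f has_integral J b) {0<..b}"
        using set_borel_integral_eq_integral[OF J(1)[OF ab(2)]] J(2)[OF ab(2)]
        by (simp add: has_integral_iff)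
      then have "((\<lambda>x. if x \<in> {0<..b} then f x else 0) has_integral J b) (cbox a b)"
        using ab by (subst has_integral_restrict) auto
      then have "((\<lambda>x. if x \<in> {0<..} then f x else 0) has_integral J b) (cbox a b)"
        by (rule has_integral_eq[rotated]) (auto split: if_splits)
      with b0[OF \<open>b \<ge> b0\<close>]
      show "\<exists>z. ((\<lambda>x. if x \<in> {0<..} then f x else 0) has_integral z) (cbox a b) \<and>
          norm (z - pi / 2 * expectation (\<lambda>\<omega>. sgn (X \<omega>))) < e"
        by (auto simp: dist_real_def)
    qed simp
  qed
qed

text \<open>The sign comes from Re (i z) = - Im z. The expectation on the right is P (0 < X) + P (X
  = 0) / 2, so that laws with an atom at 0 are covered.\<close>

lemma (in prob_space) gil_pelaez_inversion:
  fixes X :: "'a \<Rightarrow> real"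
  assumes [measurable]: "random_variable borel X"
    and bound: "\<And>\<omega>. \<omega> \<in> space M \<Longrightarrow> \<bar>X \<omega>\<bar> \<le> B"
  shows "(\<lambda>x. Re (\<i> * char (distr M borel X) x) / x) integrable_on {0<..}"
    and "1 / 2 - 1 / pi * integral {0<..} (\<lambda>x. Re (\<i> * char (distr M borel X) x) / x) =
      expectation (\<lambda>\<omega>. (1 + sgn (X \<omega>)) / 2)"
proof -
  have "((\<lambda>x. - (Im (char (distr M borel X) x) / x)) has_integral
      - (pi / 2 * expectation (\<lambda>\<omega>. sgn (X \<omega>)))) {0<..}"
    by (intro has_integral_neg gil_pelaez_bounded[OF assms(1) bound])
  then have *: "((\<lambda>x. Re (\<i> * char (distr M borel X) x) / x) has_integral
      - (pi / 2 * expectation (\<lambda>\<omega>. sgn (X \<omega>)))) {0<..}"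
    by simp
  then show "(\<lambda>x. Re (\<i> * char (distr M borel X) x) / x) integrable_on {0<..}"
    by (rule has_integral_integrable)
  have "integrable M (\<lambda>\<omega>. sgn (X \<omega>))"
    by (rule integrable_const_bound[of _ 1]) (auto simp: abs_sgn_eq)
  then have "expectation (\<lambda>\<omega>. (1 + sgn (X \<omega>)) / 2) = 1 / 2 + expectation (\<lambda>\<omega>. sgn (X \<omega>)) / 2"
    by (simp add: prob_space add_divide_distrib)
  then show "1 / 2 - 1 / pi * integral {0<..} (\<lambda>x. Re (\<i> * char (distr M borel X) x) / x) =
      expectation (\<lambda>\<omega>. (1 + sgn (X \<omega>)) / 2)"
    using integral_unique[OF *] by simp
qed

section \<open>Layer-cake formulas\<close>

text \<open>As \<open>w\<close> runs from \<open>u\<close> to \<open>L\<close>, the positive part of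
  \<open>b + w\<close> grows at rate 1 exactly where \<open>0 < b + w\<close>.\<close>

lemma pos_part_layer_cake:
  fixes b u L :: real
  assumes "0 \<le> u" "u \<le> L"
  shows "(LBINT w. indicator {w. 0 < w \<and> w \<le> L \<and> u \<le> w \<and> 0 < b + w} w) = max 0 (b + L) - max 0 (b + u)"
proof -
  let ?S = "{w. 0 < w \<and> w \<le> L \<and> u \<le> w \<and> 0 < b + w}"
  \<comment> \<open>The set is an interval starting at \<open>m\<close>; whether \<open>m\<close>
    belongs to it depends on which condition binds, hence the sandwich between the half-open and the
    closed interval.\<close>
  define m where "m = max u (- b)"
  have "{m..L} \<in> fmeasurable lborel"
    using fmeasurable_cbox[of m L] by simp
  have "?S \<in> fmeasurable lborel"
    using assms by (intro fmeasurableI2[OF \<open>{m..L} \<in> fmeasurable lborel\<close>]) (auto simp: m_def)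
  then have "measure lborel {m<..L} \<le> measure lborel ?S"
    using assms by (intro measure_mono_fmeasurable) (auto simp: m_def)
  moreover have "measure lborel ?S \<le> measure lborel {m..L}"
    using assms \<open>{m..L} \<in> fmeasurable lborel\<close>
    by (intro measure_mono_fmeasurable) (auto simp: m_def)
  ultimately have "measure lborel ?S = max 0 (L - m)"
    using measure_nonneg[of lborel ?S] by (cases "m \<le> L") auto
  also have "\<dots> = max 0 (b + L) - max 0 (b + u)"
    using assms by (auto simp: m_def max_def)
  finally show ?thesis
    by simp
qed

text \<open>Fundamental theorem of calculus on \<open>{u..L}\<close>. Encoding the range by an
  indicator of \<open>u \<le> w\<close> lets Fubini produce the distribution function later
  on.\<close>

lemma iexp_layer_cake:
  fixes x u L :: real
  assumes "0 \<le> u" "u \<le> L"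
  shows "(LBINT w. indicator {w. 0 < w \<and> w \<le> L \<and> u \<le> w} w *\<^sub>R (\<i> * complex_of_real x * iexp (x * w))) =
    iexp (x * L) - iexp (x * u)"
proof -
  have "(LBINT w. indicator {w. 0 < w \<and> w \<le> L \<and> u \<le> w} w *\<^sub>R (\<i> * complex_of_real x * iexp (x * w))) =
      (LBINT w. indicator {u..L} w *\<^sub>R (\<i> * complex_of_real x * iexp (x * w)))"
    using AE_lborel_singleton[of 0] assms
    by (intro integral_cong_AE) (auto simp: indicator_def)
  also have "\<dots> = iexp (x * L) - iexp (x * u)"
  proof (rule integral_FTC_atLeastAtMost[OF assms(2)])
    show "((\<lambda>w. iexp (x * w)) has_vector_derivative \<i> * complex_of_real x * iexp (x * w)) (at w within {u..L})" for w
    proof -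
      have "((\<lambda>w. x * w) has_vector_derivative x) (at w within {u..L})"
        by (auto intro!: derivative_eq_intros)
      from vector_diff_chain_within[OF this has_vector_derivative_iexp] show ?thesis
        by (simp add: o_def scaleR_conv_of_real mult_ac)
    qed
  qed (intro continuous_intros)
  finally show ?thesis .
qed

context prob_space
begin

text \<open>Taking expectations in \<open>pos_part_layer_cake\<close> with \<open>u\<close> random,
  Fubini turns the indicator into the joint probability of \<open>U \<le> w\<close> and
  \<open>0 < B + w\<close>, which independence factorises.\<close>

lemma expectation_pos_part_indep:
  assumes indep: "indep_var borel U borel B"
    and U: "\<And>\<omega>. \<omega> \<in> space M \<Longrightarrow> U \<omega> \<in> {0..L}"
    and B: "\<And>\<omega>. \<omega> \<in> space M \<Longrightarrow> \<bar>B \<omega>\<bar> \<le> C"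
  shows "expectation (\<lambda>\<omega>. max 0 (B \<omega> + U \<omega>)) = expectation (\<lambda>\<omega>. max 0 (B \<omega> + L)) -
    (LBINT w:{0<..L}. \<P>(\<omega> in M. U \<omega> \<le> w) * \<P>(\<omega> in M. 0 < B \<omega> + w))"
proof -
  interpret P: pair_sigma_finite "lborel :: real measure" M ..
  have [measurable]: "random_variable borel U" "random_variable borel B"
    using indep by (auto simp: indep_var_eq)
  let ?f = "\<lambda>w \<omega>. indicator {w. 0 < w \<and> w \<le> L \<and> U \<omega> \<le> w \<and> 0 < B \<omega> + w} w :: real"
  let ?g = "\<lambda>(w :: real, \<omega> :: 'a). indicator {0<..L} w :: real"
  have int: "integrable (lborel \<Otimes>\<^sub>M M) (\<lambda>(w, \<omega>). ?f w \<omega>)"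
  proof (rule Bochner_Integration.integrable_bound)
    show "integrable (lborel \<Otimes>\<^sub>M M) ?g"
    proof (intro P.Fubini_integrable)
      have "integrable lborel (indicator {0<..L} :: real \<Rightarrow> real)"
        by (cases "0 \<le> L") auto
      then show "integrable lborel (\<lambda>w. LINT \<omega>|M. norm (?g (w, \<omega>)))"
        by (simp add: prob_space)
      show "AE w in lborel. integrable M (\<lambda>\<omega>. ?g (w, \<omega>))"
        by (intro AE_I2) simp
    qed simp
    show "(\<lambda>(w, \<omega>). ?f w \<omega>) \<in> borel_measurable (lborel \<Otimes>\<^sub>M M)"
      by measurable
    show "AE z in lborel \<Otimes>\<^sub>M M. norm (case z of (w, \<omega>) \<Rightarrow> ?f w \<omega>)
        \<le> norm (?g z)"
      by (intro AE_I2) (auto simp: indicator_def split: prod.split)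
  qed
  have "(\<integral>w. (\<integral>\<omega>. ?f w \<omega> \<partial>M) \<partial>lborel) =
      (LBINT w:{0<..L}. \<P>(\<omega> in M. U \<omega> \<le> w) * \<P>(\<omega> in M. 0 < B \<omega> + w))"
    unfolding set_lebesgue_integral_def
  proof (intro Bochner_Integration.integral_cong refl)
    fix w :: real
    have "(\<integral>\<omega>. ?f w \<omega> \<partial>M) = (\<integral>\<omega>. indicator {0<..L} w * indicator {\<omega> \<in> space M. U \<omega> \<le> w \<and> 0 < B \<omega> + w} \<omega> \<partial>M)"
      by (intro Bochner_Integration.integral_cong) (auto simp: indicator_def)
    also have "\<dots> = indicator {0<..L} w * prob {\<omega> \<in> space M. U \<omega> \<le> w \<and> 0 < B \<omega> + w}"
      by simp
    also have "prob {\<omega> \<in> space M. U \<omega> \<le> w \<and> 0 < B \<omega> + w} =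
        prob ((\<lambda>\<omega>. (U \<omega>, B \<omega>)) -` ({..w} \<times> {- w<..}) \<inter> space M)"
      by (intro arg_cong[where f = prob]) auto
    also have "\<dots> = prob (U -` {..w} \<inter> space M) * prob (B -` {- w<..} \<inter> space M)"
      by (intro indep_varD[OF indep]) auto
    also have "U -` {..w} \<inter> space M = {\<omega> \<in> space M. U \<omega> \<le> w}"
      by auto
    also have "B -` {- w<..} \<inter> space M = {\<omega> \<in> space M. 0 < B \<omega> + w}"
      by auto
    finally show "(\<integral>\<omega>. ?f w \<omega> \<partial>M) =
        indicator {0<..L} w *\<^sub>R (\<P>(\<omega> in M. U \<omega> \<le> w) * \<P>(\<omega> in M. 0 < B \<omega> + w))"
      by simp
  qed
  also have "(\<integral>w. (\<integral>\<omega>. ?f w \<omega> \<partial>M) \<partial>lborel) = (\<integral>\<omega>. (\<integral>w. ?f w \<omega> \<partial>lborel) \<partial>M)"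
    using P.Fubini_integral[OF int] by simp
  also have "\<dots> = expectation (\<lambda>\<omega>. max 0 (B \<omega> + L) - max 0 (B \<omega> + U \<omega>))"
    using U by (intro Bochner_Integration.integral_cong refl pos_part_layer_cake) auto
  also have "\<dots> = expectation (\<lambda>\<omega>. max 0 (B \<omega> + L)) - expectation (\<lambda>\<omega>. max 0 (B \<omega> + U \<omega>))"
  proof (intro Bochner_Integration.integral_diff)
    have "\<bar>max 0 (B \<omega> + L)\<bar> \<le> C + L" "\<bar>max 0 (B \<omega> + U \<omega>)\<bar> \<le> C + L" if "\<omega> \<in> space M" for \<omega>
      using U[OF that] B[OF that] by (auto simp: max_def)
    then show "integrable M (\<lambda>\<omega>. max 0 (B \<omega> + L))" "integrable M (\<lambda>\<omega>. max 0 (B \<omega> + U \<omega>))"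
      by (intro integrable_const_bound[of _ "C + L"] AE_I2; simp)+
  qed
  finally show ?thesis by simp
qed

text \<open>An integration by parts that expresses the characteristic function by the distribution
  function, valid also for laws with atoms such as the one the cap creates.\<close>

lemma expectation_iexp_layer_cake:
  assumes [measurable]: "random_variable borel U"
    and U: "\<And>\<omega>. \<omega> \<in> space M \<Longrightarrow> U \<omega> \<in> {0..L}"
  shows "expectation (\<lambda>\<omega>. iexp (x * U \<omega>)) = iexp (x * L) - \<i> * complex_of_real x *
    (CLBINT w:{0<..L}. iexp (x * w) * complex_of_real (\<P>(\<omega> in M. U \<omega> \<le> w)))"
proof -
  interpret P: pair_sigma_finite "lborel :: real measure" M ..
  let ?f = "\<lambda>w \<omega>. indicator {w. 0 < w \<and> w \<le> L \<and> U \<omega> \<le> w} w *\<^sub>R (\<i> * complex_of_real x * iexp (x * w))"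
  have int: "integrable (lborel \<Otimes>\<^sub>M M) (\<lambda>(w, \<omega>). ?f w \<omega>)"
  proof (rule Bochner_Integration.integrable_bound)
    show "integrable (lborel \<Otimes>\<^sub>M M) (\<lambda>(w :: real, \<omega>). indicator {0<..L} w * \<bar>x\<bar>)"
    proof (intro P.Fubini_integrable)
      have "integrable lborel (\<lambda>w. indicator {0<..L} w * \<bar>x\<bar>)"
        by (intro integrable_mult_left) (cases "0 \<le> L", auto)
      then show "integrable lborel (\<lambda>w. LINT \<omega>|M. norm (case (w, \<omega>) of (w :: real, \<omega>) \<Rightarrow> indicator {0<..L} w * \<bar>x\<bar>))"
        by (simp add: prob_space abs_mult)
      show "AE w in lborel. integrable M (\<lambda>\<omega>. case (w, \<omega>) of (w :: real, \<omega>) \<Rightarrow> indicator {0<..L} w * \<bar>x\<bar>)"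
        by (intro AE_I2) simp
    qed simp
    show "(\<lambda>(w, \<omega>). ?f w \<omega>) \<in> borel_measurable (lborel \<Otimes>\<^sub>M M)"
      by measurable
    show "AE z in lborel \<Otimes>\<^sub>M M. norm (case z of (w, \<omega>) \<Rightarrow> ?f w \<omega>)
        \<le> norm (case z of (w :: real, \<omega>) \<Rightarrow> indicator {0<..L} w * \<bar>x\<bar>)"
      by (intro AE_I2) (auto simp: indicator_def norm_mult split: prod.split)
  qed
  have "(\<integral>w. (\<integral>\<omega>. ?f w \<omega> \<partial>M) \<partial>lborel) =
      (\<integral>w. \<i> * complex_of_real x *
        (indicator {0<..L} w *\<^sub>R (iexp (x * w) * complex_of_real (\<P>(\<omega> in M. U \<omega> \<le> w)))) \<partial>lborel)"
  proof (intro Bochner_Integration.integral_cong refl)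
    fix w :: real
    have "(\<integral>\<omega>. ?f w \<omega> \<partial>M) = (\<integral>\<omega>. indicator {\<omega> \<in> space M. U \<omega> \<le> w} \<omega> *\<^sub>R
        (indicator {0<..L} w *\<^sub>R (\<i> * complex_of_real x * iexp (x * w))) \<partial>M)"
      by (intro Bochner_Integration.integral_cong) (auto simp: indicator_def)
    also have "\<dots> = prob {\<omega> \<in> space M. U \<omega> \<le> w} *\<^sub>R
        (indicator {0<..L} w *\<^sub>R (\<i> * complex_of_real x * iexp (x * w)))"
      by (subst Bochner_Integration.integral_scaleR_left)
        (auto intro!: integrable_real_indicator simp: emeasure_eq_measure)
    finally show "(\<integral>\<omega>. ?f w \<omega> \<partial>M) = \<i> * complex_of_real x *
        (indicator {0<..L} w *\<^sub>R (iexp (x * w) * complex_of_real (\<P>(\<omega> in M. U \<omega> \<le> w))))"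
      by (simp add: scaleR_conv_of_real mult_ac)
  qed
  also have "\<dots> = \<i> * complex_of_real x *
      (CLBINT w:{0<..L}. iexp (x * w) * complex_of_real (\<P>(\<omega> in M. U \<omega> \<le> w)))"
    unfolding set_lebesgue_integral_def by (rule integral_mult_right_zero)
  also have "(\<integral>w. (\<integral>\<omega>. ?f w \<omega> \<partial>M) \<partial>lborel) = (\<integral>\<omega>. (\<integral>w. ?f w \<omega> \<partial>lborel) \<partial>M)"
    using P.Fubini_integral[OF int] by simp
  also have "\<dots> = expectation (\<lambda>\<omega>. iexp (x * L) - iexp (x * U \<omega>))"
    using U by (intro Bochner_Integration.integral_cong refl iexp_layer_cake) auto
  also have "\<dots> = iexp (x * L) - expectation (\<lambda>\<omega>. iexp (x * U \<omega>))"
    by (subst Bochner_Integration.integral_diff) (auto intro!: integrable_iexp simp: prob_space)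
  finally show ?thesis
    by (simp add: algebra_simps)
qed

end

section \<open>Independence and law of the log-returns\<close>

text \<open>Law of total probability, with \<open>q v\<close> in the role of the conditional
  probability of \<open>E\<close> given \<open>D = v\<close>. The product form of the hypothesis
  includes values \<open>v\<close> of probability zero.\<close>

lemma (in prob_space) prob_countable_mixture:
  fixes D :: "'a \<Rightarrow> 'i :: countable"
  assumes D [measurable]: "random_variable (count_space UNIV) D"
    and E [measurable]: "E \<in> events"
    and q: "\<And>v. prob (E \<inter> {\<omega> \<in> space M. D \<omega> = v}) = q v * prob {\<omega> \<in> space M. D \<omega> = v}"
    and q01: "\<And>v. 0 \<le> q v" "\<And>v. q v \<le> (1 :: real)"
  shows "prob E = expectation (\<lambda>\<omega>. q (D \<omega>))"
proof -
  have [measurable]: "{\<omega> \<in> space M. D \<omega> = v} \<in> events" for v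
    by measurable
  let ?C = "count_space (UNIV :: 'i set)"
  \<comment> \<open>The measure P (E and D in .) is compared with the \<open>q\<close>-weighted law
    of \<open>D\<close>. On a countable space atoms decide, and the total masses are the two sides
    of the claim.\<close>
  have eq: "distr (density M (indicator E)) ?C D = density (distr M ?C D) q"
  proof (rule measure_eqI_countable[of _ UNIV])
    fix v :: 'i
    have "emeasure (distr (density M (indicator E)) ?C D) {v} = emeasure M (E \<inter> {\<omega> \<in> space M. D \<omega> = v})"
      by (subst emeasure_distr, simp, simp, subst emeasure_restricted)
        (auto intro!: arg_cong[where f = "emeasure M"])
    also have "\<dots> = ennreal (q v) * emeasure M {\<omega> \<in> space M. D \<omega> = v}"
      using q01 by (simp add: emeasure_eq_measure q ennreal_mult)
    also have "\<dots> = emeasure (density (distr M ?C D) q) {v}"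
    proof -
      have "emeasure (density (distr M ?C D) q) {v} = (\<integral>\<^sup>+ x. ennreal (q x) * indicator {v} x \<partial>distr M ?C D)"
        by (simp add: emeasure_density)
      also have "\<dots> = (\<integral>\<^sup>+ x. ennreal (q v) * indicator {v} x \<partial>distr M ?C D)"
        by (intro nn_integral_cong) (auto split: split_indicator)
      also have "\<dots> = ennreal (q v) * emeasure (distr M ?C D) {v}"
        by (subst nn_integral_cmult_indicator) auto
      finally show ?thesis
        by (simp add: emeasure_distr vimage_def Int_def conj_commute)
    qed
    finally show "emeasure (distr (density M (indicator E)) ?C D) {v} =
        emeasure (density (distr M ?C D) q) {v}" .
  qed auto
  have "emeasure M E = emeasure (distr (density M (indicator E)) ?C D) UNIV"
    by (subst emeasure_distr, simp, simp, subst emeasure_restricted)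
      (auto intro!: arg_cong[where f = "emeasure M"] simp: sets.Int_space_eq2)
  also have "\<dots> = (\<integral>\<^sup>+ \<omega>. q (D \<omega>) \<partial>M)"
    by (simp add: eq emeasure_density nn_integral_distr)
  also have "\<dots> = ennreal (expectation (\<lambda>\<omega>. q (D \<omega>)))"
    using q01 by (intro nn_integral_eq_integral integrable_const_bound[of _ 1] AE_I2) auto
  finally show ?thesis
    using q01 by (simp add: emeasure_eq_measure integral_nonneg)
qed

text \<open>\<open>process_sigma\<close> is a bare family of sets; wrapping it into a measure space
  makes measurability rules applicable to it.\<close>

lemma sets_process_sigma:
  "sets (sigma (space M) (process_sigma M B I X)) = process_sigma M B I X"
proof -
  let ?G = "\<Union>i\<in>I. {X i -` A \<inter> space M | A. A \<in> sets B}"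
  have G: "?G \<subseteq> Pow (space M)"
    by auto
  then have "sigma_sets (space M) ?G \<subseteq> Pow (space M)"
    using sigma_sets_into_sp by blast
  then show ?thesis
    unfolding process_sigma_def by (simp only: sets_measure_of sigma_sets_sigma_sets_eq[OF G])
qed

lemma process_sigma_measurable:
  assumes "i \<in> I" "X i \<in> measurable M B"
  shows "X i \<in> measurable (sigma (space M) (process_sigma M B I X)) B"
proof (rule measurableI)
  fix A assume "A \<in> sets B"
  then have "X i -` A \<inter> space M \<in> process_sigma M B I X"
    unfolding process_sigma_def using assms(1) by (intro sigma_sets.Basic) blast
  then show "X i -` A \<inter> space (sigma (space M) (process_sigma M B I X)) \<in>
      sets (sigma (space M) (process_sigma M B I X))"
    by (simp only: sets_process_sigma space_measure_of_conv)
qed (use assms in \<open>simp add: space_measure_of_conv measurable_space\<close>)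

section \<open>The drivers observed at the resetting times\<close>

locale jump_drivers = prob_space M for M :: "'a measure" +
  fixes W :: "real \<Rightarrow> 'a \<Rightarrow> real" and N :: "real \<Rightarrow> 'a \<Rightarrow> nat" and Y :: "nat \<Rightarrow> 'a \<Rightarrow> real"
    and T lam \<mu> \<delta> \<tau> :: real and t :: "nat \<Rightarrow> real" and n :: nat
  assumes brownian: "std_brownian_motion M T W"
    and poisson: "poisson_process M T lam N"
    and jump_law: "\<And>j. j \<ge> 1 \<Longrightarrow> distributed M lborel (Y j) (normal_density \<mu> \<delta>)"
    and indep: "independent_drivers M T W N Y"
    and pos: "lam > 0" "\<delta> > 0" "\<tau> > 0" "t 0 \<ge> 0" "n \<ge> 1"
    and step: "\<And>i. i < n \<Longrightarrow> t (Suc i) = t i + \<tau>"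
    and horizon: "t n \<le> T"
begin

lemma time_eq: "i \<le> n \<Longrightarrow> t i = t 0 + real i * \<tau>"
  by (induction i) (auto simp: step algebra_simps)

lemma time_bounds: "i \<le> n \<Longrightarrow> 0 \<le> t i" "i \<le> n \<Longrightarrow> t i \<le> T"
proof -
  assume i: "i \<le> n"
  show "0 \<le> t i"
    using pos by (simp add: time_eq[OF i])
  have "t i \<le> t n"
    using i pos by (simp add: time_eq[OF i] time_eq[OF order_refl])
  then show "t i \<le> T"
    using horizon by simp
qed

lemma measurable_W [measurable]: "i \<le> n \<Longrightarrow> random_variable borel (W (t i))"
  using brownian time_bounds[of i] by (simp add: std_brownian_motion_def)

lemma measurable_N [measurable]: "i \<le> n \<Longrightarrow> random_variable (count_space UNIV) (N (t i))"
  using poisson time_bounds[of i] by (simp add: poisson_process_def)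

lemma measurable_Y [measurable]: "j \<ge> 1 \<Longrightarrow> random_variable borel (Y j)"
  using jump_law[of j] by (simp add: distributed_def)

definition W_incr :: "nat \<Rightarrow> 'a \<Rightarrow> real" where
  "W_incr i \<omega> = W (t (Suc i)) \<omega> - W (t i) \<omega>"

definition N_incr :: "nat \<Rightarrow> 'a \<Rightarrow> nat" where
  "N_incr i \<omega> = N (t (Suc i)) \<omega> - N (t i) \<omega>"

text \<open>The index range is itself random, so independence of different periods is not immediate.
  Should the counts decrease, which happens on a null set only, the range is empty and the sum
  0.\<close>

definition log_jump :: "nat \<Rightarrow> 'a \<Rightarrow> real" where
  "log_jump i \<omega> = (\<Sum>j\<in>{N (t i) \<omega><..N (t (Suc i)) \<omega>}. Y j \<omega>)"

text \<open>Lists of naturals form a countable type, so events can be split by this value. Absolute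
  counts are recorded, not increments, because they determine which \<open>Y j\<close> enter a
  period.\<close>

definition counts :: "'a \<Rightarrow> nat list" where
  "counts \<omega> = map (\<lambda>i. N (t i) \<omega>) [0..<Suc n]"

lemma measurable_W_incr [measurable]: "i < n \<Longrightarrow> random_variable borel (W_incr i)"
  unfolding W_incr_def[abs_def] by measurable

lemma measurable_N_incr [measurable]: "i < n \<Longrightarrow> random_variable (count_space UNIV) (N_incr i)"
  unfolding N_incr_def[abs_def] by measurable

text \<open>Both random end points of the range take countably many values and are frozen one after
  the other.\<close>

lemma measurable_log_jump [measurable]: "i < n \<Longrightarrow> random_variable borel (log_jump i)"
proof -
  assume i: "i < n"
  have "(\<lambda>\<omega>. \<Sum>j\<in>{a<..b}. Y j \<omega>) \<in> borel_measurable M" for a b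
    by (intro borel_measurable_sum measurable_Y) auto
  then have "(\<lambda>\<omega>. \<Sum>j\<in>{a<..N (t (Suc i)) \<omega>}. Y j \<omega>) \<in> borel_measurable M" for a
    by (rule measurable_compose_countable[where f = "\<lambda>b \<omega>. \<Sum>j\<in>{a<..b}. Y j \<omega>"])
      (use i in simp)
  then have "(\<lambda>\<omega>. \<Sum>j\<in>{N (t i) \<omega><..N (t (Suc i)) \<omega>}. Y j \<omega>) \<in> borel_measurable M"
    by (rule measurable_compose_countable[where f = "\<lambda>a \<omega>. \<Sum>j\<in>{a<..N (t (Suc i)) \<omega>}. Y j \<omega>"])
      (use i in simp)
  then show ?thesis
    by (simp add: log_jump_def[abs_def])
qed

lemma counts_eq_iff: "counts \<omega> = v \<longleftrightarrow> length v = Suc n \<and> (\<forall>i\<le>n. N (t i) \<omega> = v ! i)"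
proof -
  have "counts \<omega> = v \<longleftrightarrow> length v = Suc n \<and> (\<forall>i<Suc n. counts \<omega> ! i = v ! i)"
    by (subst list_eq_iff_nth_eq) (auto simp: counts_def)
  also have "\<dots> \<longleftrightarrow> length v = Suc n \<and> (\<forall>i<Suc n. N (t i) \<omega> = v ! i)"
    unfolding counts_def by (simp add: nth_map del: upt_Suc)
  finally show ?thesis
    by (simp only: less_Suc_eq_le)
qed

text \<open>\<open>F\<close> is left open because the claim is applied both to \<open>M\<close> and
  to the sigma-algebra generated by \<open>N\<close> alone, where independence lives.\<close>

lemma measurable_counts_wrt:
  assumes "space F = space M" "\<And>i. i \<le> n \<Longrightarrow> N (t i) \<in> measurable F (count_space UNIV)"
  shows "counts \<in> measurable F (count_space UNIV)"
proof -
  have "counts -` {v} \<inter> space F \<in> sets F" for v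
  proof -
    have "counts -` {v} \<inter> space F = (if length v = Suc n then \<Inter>i\<in>{..n}. N (t i) -` {v ! i} \<inter> space F else {})"
      unfolding vimage_def singleton_iff counts_eq_iff by auto
    also have "\<dots> \<in> sets F"
    proof -
      have "(\<Inter>i\<in>{..n}. N (t i) -` {v ! i} \<inter> space F) \<in> sets F"
        using measurable_sets[OF assms(2)] by (intro sets.finite_INT) auto
      then show ?thesis
        by simp
    qed
    finally show ?thesis .
  qed
  then show ?thesis
    by (intro measurable_count_space_eq2_countable[THEN iffD2]) auto
qed

lemma measurable_counts [measurable]: "random_variable (count_space UNIV) counts"
  by (rule measurable_counts_wrt) auto

end

section \<open>A finite family of independent real-valued sources\<close>

datatype source = Counts | Increment nat | Jump nat

context jump_drivers
begin

text \<open>The counting process enters through the code of its finitely many values only, so that all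
  sources of randomness become real-valued.\<close>

primrec source_var :: "source \<Rightarrow> 'a \<Rightarrow> real" where
  "source_var Counts = (\<lambda>\<omega>. real (to_nat (counts \<omega>)))"
| "source_var (Increment i) = W_incr i"
| "source_var (Jump j) = Y j"

text \<open>The cut-off \<open>m\<close> keeps the family finite; with the counts frozen it is set
  to the largest jump index that occurs.\<close>

definition sources :: "nat \<Rightarrow> source set" where
  "sources m = {Counts} \<union> Increment ` {..<n} \<union> Jump ` {1..m}"

lemma indep_W_incr: "indep_vars (\<lambda>_. borel) W_incr {..<n}"
proof -
  have "indep_vars (\<lambda>_. borel) (\<lambda>i \<omega>. W (t (Suc i)) \<omega> - W (t i) \<omega>) {..<n}"
    using brownian time_bounds[of 0] step pos horizon by (simp add: std_brownian_motion_def)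
  then show ?thesis
    by (simp add: W_incr_def[abs_def])
qed

lemma indep_N_incr: "indep_vars (\<lambda>_. count_space UNIV) N_incr {..<n}"
proof -
  have "indep_vars (\<lambda>_. count_space UNIV) (\<lambda>i \<omega>. N (t (Suc i)) \<omega> - N (t i) \<omega>) {..<n}"
    using poisson time_bounds[of 0] step pos horizon by (simp add: poisson_process_def)
  then show ?thesis
    by (simp add: N_incr_def[abs_def])
qed

lemma measurable_source_var: "k \<in> sources m \<Longrightarrow> random_variable borel (source_var k)"
  by (auto simp: sources_def)

text \<open>Two layers of independence are combined: that of the drivers from each other, and that
  of the Brownian increments within the single driver \<open>W\<close>.\<close>

lemma indep_sources: "indep_vars (\<lambda>_. borel) source_var (sources m)"
proof -
  let ?F = "\<lambda>k. {source_var k -` A \<inter> space M |A. A \<in> sets borel}"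
  let ?I = "{Brownian, Jump_times} \<union> Jump_size ` {1..m}"
  have drivers: "indep_sets (driver_sigma M T W N Y) ?I"
    using indep unfolding independent_drivers_def by (rule indep_sets_mono_index[rotated]) auto
  have "indep_sets ?F (sources m)"
  \<comment> \<open>Every family contains the whole space, so the product rule for the full index
    set covers all its subsets.\<close>
  proof (subst indep_sets_finite)
    show "sources m \<noteq> {}" "finite (sources m)"
      by (auto simp: sources_def)
    show "?F k \<subseteq> events" if "k \<in> sources m" for k
      using measurable_source_var[OF that] by (auto intro: measurable_sets)
    show "space M \<in> ?F k" for k
      by (auto intro!: exI[of _ UNIV])
    show "\<forall>A\<in>Pi (sources m) ?F. prob (\<Inter> (A ` sources m)) = (\<Prod>j\<in>sources m. prob (A j))"
    proof
      fix A assume A: "A \<in> Pi (sources m) ?F"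
      have "\<exists>B. \<forall>k\<in>sources m. B k \<in> sets borel \<and> A k = source_var k -` B k \<inter> space M"
        using A by (intro bchoice) (auto simp: Pi_iff)
      then obtain B where B: "\<And>k. k \<in> sources m \<Longrightarrow> B k \<in> sets borel"
        "\<And>k. k \<in> sources m \<Longrightarrow> A k = source_var k -` B k \<inter> space M"
        by blast
      \<comment> \<open>One event per driver: the events of all Brownian increments are merged into
        their intersection, which is split again by \<open>indep_W_incr\<close>.\<close>
      define A' where "A' d = (case d of Brownian \<Rightarrow> \<Inter>i<n. A (Increment i) | Jump_times \<Rightarrow> A Counts
        | Jump_size j \<Rightarrow> A (Jump j))" for d
      have nonempty: "{..<n} \<noteq> {}"
        using pos(5) by (auto simp: lessThan_empty_iff)
      have "A' d \<in> driver_sigma M T W N Y d" if "d \<in> ?I" for d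
      proof (cases d)
        case Brownian
        let ?S = "sigma (space M) (process_sigma M borel {0..T} W)"
        have W: "W (t i) \<in> measurable ?S borel" if "i \<le> n" for i
          using that time_bounds[OF that] by (intro process_sigma_measurable) auto
        have "A (Increment i) \<in> sets ?S" if "i < n" for i
        proof -
          have "W_incr i \<in> measurable ?S borel"
            unfolding W_incr_def[abs_def] using that by (intro borel_measurable_diff W) auto
          then have "W_incr i -` B (Increment i) \<inter> space ?S \<in> sets ?S"
            using B(1)[of "Increment i"] that by (intro measurable_sets) (auto simp: sources_def)
          then show ?thesis
            using B(2)[of "Increment i"] that by (auto simp: sources_def space_measure_of_conv)
        qed
        then have "(\<Inter>i<n. A (Increment i)) \<in> sets ?S"
          using nonempty by (intro sets.finite_INT) auto
        then show ?thesis
          by (simp only: sets_process_sigma A'_def Brownian driver.case driver_sigma.simps)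
      next
        case Jump_times
        let ?S = "sigma (space M) (process_sigma M (count_space UNIV) {0..T} N)"
        have "N (t i) \<in> measurable ?S (count_space UNIV)" if "i \<le> n" for i
          using that time_bounds[OF that] by (intro process_sigma_measurable) auto
        then have "counts \<in> measurable ?S (count_space UNIV)"
          by (intro measurable_counts_wrt) (auto simp: space_measure_of_conv)
        then have "source_var Counts \<in> measurable ?S borel"
          unfolding source_var.simps by measurable
        then have "source_var Counts -` B Counts \<inter> space ?S \<in> sets ?S"
          using B(1)[of Counts] by (intro measurable_sets) (auto simp: sources_def)
        then have "A Counts \<in> sets ?S"
          using B(2)[of Counts] by (auto simp: sources_def space_measure_of_conv)
        then show ?thesis
          by (simp only: sets_process_sigma A'_def Jump_times driver.case driver_sigma.simps)
      next
        case (Jump_size j)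
        then have "j \<in> {1..m}"
          using that by auto
        then show ?thesis
          using B[of "Jump j"] by (auto simp: Jump_size A'_def sources_def process_sigma_def
              intro!: sigma_sets.Basic)
      qed
      then have "prob (\<Inter>d\<in>?I. A' d) = (\<Prod>d\<in>?I. prob (A' d))"
        by (intro indep_setsD[OF drivers]) auto
      also have "\<dots> = prob (\<Inter>i<n. A (Increment i)) * prob (A Counts) * (\<Prod>j\<in>{1..m}. prob (A (Jump j)))"
        by (subst prod.union_disjoint) (auto simp: prod.reindex inj_on_def A'_def)
      also have "prob (\<Inter>i<n. A (Increment i)) = prob (\<Inter>i<n. W_incr i -` B (Increment i) \<inter> space M)"
        using B(2) by (intro arg_cong[where f = prob]) (auto simp: sources_def)
      also have "\<dots> = (\<Prod>i<n. prob (W_incr i -` B (Increment i) \<inter> space M))"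
        using B(1) nonempty by (intro indep_varsD_finite[OF indep_W_incr]) (auto simp: sources_def)
      also have "\<dots> = (\<Prod>i<n. prob (A (Increment i)))"
        using B(2) by (intro prod.cong) (auto simp: sources_def)
      also have "(\<Prod>i<n. prob (A (Increment i))) * prob (A Counts) * (\<Prod>j\<in>{1..m}. prob (A (Jump j))) =
          (\<Prod>j\<in>sources m. prob (A j))"
        unfolding sources_def
        by (subst prod.union_disjoint; (subst prod.union_disjoint)?)
          (auto simp: prod.reindex inj_on_def mult_ac)
      also have "(\<Inter>d\<in>?I. A' d) = (\<Inter>k\<in>sources m. A k)"
        by (auto simp: A'_def sources_def)
      finally show "prob (\<Inter> (A ` sources m)) = (\<Prod>j\<in>sources m. prob (A j))" .
    qed
  qed
  then show ?thesis
    unfolding indep_vars_def2 using measurable_source_var by auto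
qed

end

section \<open>Normal laws of the periods for frozen jump counts\<close>

context prob_space
begin

lemma normal_distributed_le:
  assumes X: "distributed M lborel X (normal_density m s)" and "s > 0"
  shows "\<P>(\<omega> in M. X \<omega> \<le> x) = cdf std_normal_distribution ((x - m) / s)"
proof -
  have rv [measurable]: "random_variable borel X"
    using X by (simp add: distributed_def)
  have "distributed M lborel (\<lambda>\<omega>. (X \<omega> - m) / s) std_normal_density"
    using X normal_standard_normal_convert[OF \<open>s > 0\<close>] by simp
  then have D: "distr M lborel (\<lambda>\<omega>. (X \<omega> - m) / s) = std_normal_distribution"
    by (simp add: distributed_def)
  have "{\<omega> \<in> space M. X \<omega> \<le> x} = (\<lambda>\<omega>. (X \<omega> - m) / s) -` {..(x - m) / s} \<inter> space M"
    using \<open>s > 0\<close> by (auto simp: divide_le_cancel)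
  then have "\<P>(\<omega> in M. X \<omega> \<le> x) = measure (distr M lborel (\<lambda>\<omega>. (X \<omega> - m) / s)) {..(x - m) / s}"
    by (simp add: measure_distr)
  then show ?thesis
    by (simp add: D cdf_def)
qed

lemma distributed_prob_density:
  assumes X: "distributed M lborel X f" and A: "A \<in> sets borel"
  shows "\<P>(\<omega> in M. X \<omega> \<in> A) = measure (density lborel f) A"
proof -
  have "\<P>(\<omega> in M. X \<omega> \<in> A) = measure (distr M lborel X) A"
    using X A by (subst measure_distr) (auto simp: distributed_def intro!: arg_cong[where f = prob])
  then show ?thesis
    using X by (simp add: distributed_def)
qed

end

context jump_drivers
begin

text \<open>The law of a log-return without its drift, given \<open>d\<close> jumps in the period.
  Products of such values are the conditional probabilities fed into
  \<open>prob_countable_mixture\<close>.\<close>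

definition normal_prob :: "real \<Rightarrow> nat \<Rightarrow> real set \<Rightarrow> real" where
  "normal_prob s d A =
     measure (density lborel (normal_density (real d * \<mu>) (sqrt (s\<^sup>2 * \<tau> + real d * \<delta>\<^sup>2)))) A"

lemma normal_prob:
  assumes "s > 0"
  shows "0 \<le> normal_prob s d A" "normal_prob s d A \<le> 1" "normal_prob s d UNIV = 1"
proof -
  interpret P: prob_space "density lborel (normal_density (real d * \<mu>) (sqrt (s\<^sup>2 * \<tau> + real d * \<delta>\<^sup>2)))"
    using std_variance_pos[of s \<tau> d \<delta>] assms pos by (intro prob_space_normal_density) auto
  show "0 \<le> normal_prob s d A" "normal_prob s d A \<le> 1" "normal_prob s d UNIV = 1"
    using P.prob_space by (auto simp: normal_prob_def)
qed

lemma normal_prob_atMost: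
  assumes "s > 0"
  shows "normal_prob s d {..x} =
    cdf std_normal_distribution ((x - real d * \<mu>) / sqrt (s\<^sup>2 * \<tau> + real d * \<delta>\<^sup>2))"
proof -
  let ?P = "density lborel (normal_density (real d * \<mu>) (sqrt (s\<^sup>2 * \<tau> + real d * \<delta>\<^sup>2)))"
  have v: "sqrt (s\<^sup>2 * \<tau> + real d * \<delta>\<^sup>2) > 0"
    using std_variance_pos[of s \<tau> d \<delta>] assms pos by simp
  interpret P: prob_space ?P
    using v by (intro prob_space_normal_density)
  have "distr ?P lborel (\<lambda>x. x) = ?P"
    by (intro distr_id2) simp
  then have "distributed ?P lborel (\<lambda>x. x) (normal_density (real d * \<mu>) (sqrt (s\<^sup>2 * \<tau> + real d * \<delta>\<^sup>2)))"
    by (simp add: distributed_def)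
  from P.normal_distributed_le[OF this v, of x] show ?thesis
    by (simp add: normal_prob_def atMost_def)
qed

lemma W_incr_law: "i < n \<Longrightarrow> distributed M lborel (W_incr i) (normal_density 0 (sqrt \<tau>))"
  using brownian time_bounds[of i] time_bounds[of "Suc i"] pos(3) step[of i]
  unfolding std_brownian_motion_def W_incr_def[abs_def]
  by (metis Suc_leI add_diff_cancel_left' less_add_same_cancel1 less_imp_le_nat)

text \<open>A sum of independent normals over a deterministic range: the Brownian part contributes
  variance \<open>s\<^sup>2 * \<tau>\<close>, each of the \<open>b - a\<close> jumps mean \<mu> and
  variance \<open>\<delta>\<^sup>2\<close>.\<close>

lemma block_law:
  assumes i: "i < n" and s: "s > 0" and ab: "a \<le> b"
  shows "distributed M lborel (\<lambda>\<omega>. s * W_incr i \<omega> + (\<Sum>j\<in>{a<..b}. Y j \<omega>))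
    (normal_density (real (b - a) * \<mu>) (sqrt (s\<^sup>2 * \<tau> + real (b - a) * \<delta>\<^sup>2)))"
proof -
  let ?J = "Jump ` {a<..b}"
  let ?I = "insert (Increment i) ?J"
  define X where "X k \<omega> = (case k of Increment _ \<Rightarrow> s | _ \<Rightarrow> 1) * source_var k \<omega>" for k \<omega>
  define m where "m k = (case k of Increment _ \<Rightarrow> 0 | _ \<Rightarrow> \<mu>)" for k
  define v where "v k = (case k of Increment _ \<Rightarrow> s * sqrt \<tau> | _ \<Rightarrow> \<delta>)" for k
  have "indep_vars (\<lambda>_. borel) source_var ?I"
    by (rule indep_vars_subset[OF indep_sources[of b]]) (use i in \<open>auto simp: sources_def\<close>)
  then have "indep_vars (\<lambda>_. borel) X ?I"
    unfolding X_def[abs_def] by (rule indep_vars_compose2) auto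
  moreover have "distributed M lborel (X k) (normal_density (m k) (v k))" if "k \<in> ?I" for k
    using that
  proof
    assume k: "k = Increment i"
    have "distributed M lborel (\<lambda>\<omega>. 0 + s * W_incr i \<omega>) (normal_density (0 + s * 0) (\<bar>s\<bar> * sqrt \<tau>))"
      using s pos by (intro normal_density_affine W_incr_law i) auto
    then show ?thesis
      using s by (simp add: k X_def[abs_def] m_def v_def)
  next
    assume "k \<in> ?J"
    then obtain j where "k = Jump j" "j \<ge> 1"
      by auto
    then show ?thesis
      using jump_law[of j] by (simp add: X_def[abs_def] m_def v_def)
  qed
  moreover have "0 < v k" for k
    using s pos by (auto simp: v_def split: source.split)
  ultimately have "distributed M lborel (\<lambda>\<omega>. \<Sum>k\<in>?I. X k \<omega>)
      (normal_density (\<Sum>k\<in>?I. m k) (sqrt (\<Sum>k\<in>?I. (v k)\<^sup>2)))"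
    by (intro sum_indep_normal) auto
  moreover have "(\<Sum>k\<in>?I. f k) = f (Increment i) + (\<Sum>j\<in>{a<..b}. f (Jump j))" for f :: "source \<Rightarrow> real"
    by (subst sum.insert) (auto simp: sum.reindex inj_on_def)
  ultimately show ?thesis
    using s pos ab by (simp add: X_def m_def v_def power_mult_distrib)
qed

text \<open>For frozen nondecreasing counts the periods draw on disjoint blocks of sources, also
  disjoint from \<open>Counts\<close>; functions of disjoint blocks are independent.\<close>

lemma block_independence:
  assumes s: "\<And>i. i < n \<Longrightarrow> s i > 0"
    and \<nu>: "\<And>i. i < n \<Longrightarrow> \<nu> ! i \<le> \<nu> ! Suc i"
    and A: "\<And>i. i < n \<Longrightarrow> A i \<in> sets borel"
  shows "prob ({\<omega> \<in> space M. counts \<omega> = \<nu>} \<inter>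
      (\<Inter>i<n. {\<omega> \<in> space M. s i * W_incr i \<omega> + (\<Sum>j\<in>{\<nu> ! i<..\<nu> ! Suc i}. Y j \<omega>) \<in> A i})) =
    prob {\<omega> \<in> space M. counts \<omega> = \<nu>} * (\<Prod>i<n. normal_prob (s i) (\<nu> ! Suc i - \<nu> ! i) (A i))"
proof -
  \<comment> \<open>Block 0 is reserved for the counts, so period \<open>i\<close> receives the
    number \<open>Suc i\<close>.\<close>
  define K where "K k = (case k of 0 \<Rightarrow> {Counts} | Suc i \<Rightarrow> insert (Increment i) (Jump ` {\<nu> ! i<..\<nu> ! Suc i}))" for k
  define g where "g k f = (case k of 0 \<Rightarrow> f Counts
    | Suc i \<Rightarrow> s i * f (Increment i) + (\<Sum>j\<in>{\<nu> ! i<..\<nu> ! Suc i}. f (Jump j)))" for k and f :: "source \<Rightarrow> real"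
  \<comment> \<open>Injectivity of \<open>to_nat\<close> makes the event
    \<open>counts \<omega> = \<nu>\<close> an event about a real number.\<close>
  define A' where "A' k = (case k of 0 \<Rightarrow> {real (to_nat \<nu>)} | Suc i \<Rightarrow> A i)" for k
  define Z where "Z k \<omega> = g k (restrict (\<lambda>i. source_var i \<omega>) (K k))" for k \<omega>
  have mono: "\<nu> ! i \<le> \<nu> ! j" if "i \<le> j" "j \<le> n" for i j
    using that by (induction j rule: dec_induct) (use \<nu> in \<open>auto intro: order_trans\<close>)
  have K: "K k \<subseteq> sources (\<nu> ! n)" if "k \<in> {..<Suc n}" for k
  proof (cases k)
    case (Suc i)
    then show ?thesis
      using that mono[of "Suc i" n] by (auto simp: K_def sources_def)
  qed (auto simp: K_def sources_def)
  have disj: "K k \<inter> K l = {}" if "k < l" "l < Suc n" for k l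
  proof (cases k)
    case 0
    then show ?thesis
      using that by (cases l) (auto simp: K_def)
  next
    case (Suc i)
    with that obtain j where "l = Suc j" "i < j" "j < n"
      by (cases l) auto
    then show ?thesis
      using mono[of "Suc i" j] Suc by (auto simp: K_def)
  qed
  then have "disjoint_family_on K {..<Suc n}"
    unfolding disjoint_family_on_def by (metis Int_commute lessThan_iff linorder_neqE_nat)
  then have "indep_vars (\<lambda>k. PiM (K k) (\<lambda>_. borel)) (\<lambda>k \<omega>. restrict (\<lambda>i. source_var i \<omega>) (K k)) {..<Suc n}"
    using K by (intro indep_vars_restrict[OF indep_sources[of "\<nu> ! n"]])
  then have indep: "indep_vars (\<lambda>_. borel) Z {..<Suc n}"
    unfolding Z_def[abs_def]
  proof (rule indep_vars_compose2)
    fix k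
    show "g k \<in> borel_measurable (PiM (K k) (\<lambda>_. borel))"
      unfolding g_def[abs_def] K_def
      by (cases k) (auto intro!: borel_measurable_add borel_measurable_times borel_measurable_sum
          measurable_component_singleton)
  qed
  have Z0: "Z 0 -` A' 0 \<inter> space M = {\<omega> \<in> space M. counts \<omega> = \<nu>}"
    by (auto simp: Z_def g_def K_def A'_def)
  have ZS: "Z (Suc i) -` A' (Suc i) \<inter> space M =
      {\<omega> \<in> space M. s i * W_incr i \<omega> + (\<Sum>j\<in>{\<nu> ! i<..\<nu> ! Suc i}. Y j \<omega>) \<in> A i}" for i
    by (auto simp: Z_def g_def K_def A'_def)
  have "prob (\<Inter>k<Suc n. Z k -` A' k \<inter> space M) = (\<Prod>k<Suc n. prob (Z k -` A' k \<inter> space M))"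
    by (rule indep_varsD_finite[OF indep]) (auto simp: A'_def A split: nat.split)
  also have "(\<Prod>k<Suc n. prob (Z k -` A' k \<inter> space M)) = prob (Z 0 -` A' 0 \<inter> space M) *
      (\<Prod>i<n. prob (Z (Suc i) -` A' (Suc i) \<inter> space M))"
    by (rule prod.lessThan_Suc_shift)
  also have "(\<Prod>i<n. prob (Z (Suc i) -` A' (Suc i) \<inter> space M)) =
      (\<Prod>i<n. normal_prob (s i) (\<nu> ! Suc i - \<nu> ! i) (A i))"
    unfolding ZS normal_prob_def
    by (intro prod.cong refl distributed_prob_density block_law) (use s \<nu> A in auto)
  also have "(\<Inter>k<Suc n. Z k -` A' k \<inter> space M) = (Z 0 -` A' 0 \<inter> space M) \<inter>
      (\<Inter>i<n. Z (Suc i) -` A' (Suc i) \<inter> space M)"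
    unfolding lessThan_Suc_eq_insert_0 by auto
  finally show ?thesis
    unfolding Z0 ZS .
qed

text \<open>The volatility is an argument while the drivers stay the same; through this coupling the
  returns depend continuously on it along each path.\<close>

definition log_incr :: "real \<Rightarrow> nat \<Rightarrow> 'a \<Rightarrow> real" where
  "log_incr s i \<omega> = s * W_incr i \<omega> + log_jump i \<omega>"

lemma measurable_log_incr [measurable]: "i < n \<Longrightarrow> random_variable borel (log_incr s i)"
  unfolding log_incr_def[abs_def] by measurable

lemma AE_mono_counts: "AE \<omega> in M. \<forall>i<n. N (t i) \<omega> \<le> N (t (Suc i)) \<omega>"
proof -
  have "AE \<omega> in M. mono_on {0..T} (\<lambda>t. N t \<omega>)"
    using poisson by (auto simp: poisson_process_def)
  then show ?thesis
  proof eventually_elim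
    case (elim \<omega>)
    show ?case
    proof (intro allI impI)
      fix i assume "i < n"
      then show "N (t i) \<omega> \<le> N (t (Suc i)) \<omega>"
        using time_bounds[of i] time_bounds[of "Suc i"] step[of i] pos
        by (intro mono_onD[OF elim]) auto
    qed
  qed
qed

text \<open>Conditionally on the counts the probability is a product whose factors depend on the
  increments of \<open>N\<close> only; these are independent, so the expectation factorises once
  more. Each period has its own volatility, as the telescoping argument requires.\<close>

lemma log_incr_joint:
  assumes s: "\<And>i. i < n \<Longrightarrow> s i > 0" and A: "\<And>i. i < n \<Longrightarrow> A i \<in> sets borel"
  shows "prob (\<Inter>i<n. {\<omega> \<in> space M. log_incr (s i) i \<omega> \<in> A i}) =
    (\<Prod>i<n. expectation (\<lambda>\<omega>. normal_prob (s i) (N_incr i \<omega>) (A i)))"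
proof -
  let ?E = "\<Inter>i<n. {\<omega> \<in> space M. log_incr (s i) i \<omega> \<in> A i}"
  define q where "q \<nu> = (\<Prod>i<n. normal_prob (s i) (\<nu> ! Suc i - \<nu> ! i) (A i))" for \<nu>
  have ne: "{..<n} \<noteq> {}"
    using pos(5) by (auto simp: lessThan_empty_iff)
  have ev: "{\<omega> \<in> space M. log_incr (s i) i \<omega> \<in> A i} \<in> events" if "i < n" for i
    using measurable_sets[OF measurable_log_incr[OF that] A[OF that]]
    by (simp add: vimage_def Int_def conj_commute)
  have "prob ?E = expectation (\<lambda>\<omega>. q (counts \<omega>))"
  proof (rule prob_countable_mixture)
    show "?E \<in> events"
      using ev ne by (intro sets.finite_INT) auto
    show "prob (?E \<inter> {\<omega> \<in> space M. counts \<omega> = \<nu>}) = q \<nu> * prob {\<omega> \<in> space M. counts \<omega> = \<nu>}" for \<nu>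
    \<comment> \<open>Lists of the wrong length or with a decrease are values of
      \<open>counts\<close> with probability zero, and both sides vanish.\<close>
    proof (cases "length \<nu> = Suc n \<and> (\<forall>i<n. \<nu> ! i \<le> \<nu> ! Suc i)")
      case True
      have "?E \<inter> {\<omega> \<in> space M. counts \<omega> = \<nu>} = {\<omega> \<in> space M. counts \<omega> = \<nu>} \<inter>
          (\<Inter>i<n. {\<omega> \<in> space M. s i * W_incr i \<omega> + (\<Sum>j\<in>{\<nu> ! i<..\<nu> ! Suc i}. Y j \<omega>) \<in> A i})"
        unfolding log_incr_def log_jump_def counts_eq_iff by auto
      then show ?thesis
        using block_independence[of s \<nu> A] s A True by (simp add: q_def mult.commute)
    next
      case False
      have "AE \<omega> in M. \<not> counts \<omega> = \<nu>"
        using AE_mono_counts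
        by eventually_elim (use False in \<open>metis counts_eq_iff Suc_leI less_imp_le_nat\<close>)
      then have "prob {\<omega> \<in> space M. counts \<omega> = \<nu>} = 0"
        by (subst prob_eq_0) auto
      moreover have "prob (?E \<inter> {\<omega> \<in> space M. counts \<omega> = \<nu>}) \<le> prob {\<omega> \<in> space M. counts \<omega> = \<nu>}"
        by (intro finite_measure_mono) auto
      ultimately show ?thesis
        using measure_nonneg[of M "?E \<inter> {\<omega> \<in> space M. counts \<omega> = \<nu>}"] by simp
    qed
    show "0 \<le> q \<nu>" "q \<nu> \<le> 1" for \<nu>
      using normal_prob s by (auto simp: q_def intro!: prod_nonneg prod_le_1)
  qed simp
  also have "\<dots> = expectation (\<lambda>\<omega>. \<Prod>i<n. normal_prob (s i) (N_incr i \<omega>) (A i))"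
  proof (intro Bochner_Integration.integral_cong refl)
    fix \<omega>
    have "counts \<omega> ! i = N (t i) \<omega>" if "i \<le> n" for i
      using counts_eq_iff[of \<omega> "counts \<omega>"] that by simp
    then show "q (counts \<omega>) = (\<Prod>i<n. normal_prob (s i) (N_incr i \<omega>) (A i))"
      by (auto simp: q_def N_incr_def intro!: prod.cong)
  qed
  also have "\<dots> = (\<Prod>i<n. expectation (\<lambda>\<omega>. normal_prob (s i) (N_incr i \<omega>) (A i)))"
  proof (rule indep_vars_lebesgue_integral)
    show "indep_vars (\<lambda>_. borel) (\<lambda>i \<omega>. normal_prob (s i) (N_incr i \<omega>) (A i)) {..<n}"
      by (rule indep_vars_compose2[OF indep_N_incr]) auto
    show "integrable M (\<lambda>\<omega>. normal_prob (s i) (N_incr i \<omega>) (A i))" if "i \<in> {..<n}" for i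
      using that normal_prob[OF s[of i]]
      by (intro integrable_const_bound[of _ 1] measurable_compose[OF measurable_N_incr]) auto
  qed simp
  finally show ?thesis .
qed

text \<open>\<open>log_incr_joint\<close> with \<open>UNIV\<close> in all other periods, where the
  factors become 1.\<close>

lemma log_incr_prob:
  assumes i: "i < n" and s: "s > 0" and A: "A \<in> sets borel"
  shows "\<P>(\<omega> in M. log_incr s i \<omega> \<in> A) = expectation (\<lambda>\<omega>. normal_prob s (N_incr i \<omega>) A)"
proof -
  define B where "B j = (if j = i then A else UNIV)" for j
  have "prob (\<Inter>j<n. {\<omega> \<in> space M. log_incr s j \<omega> \<in> B j}) =
      (\<Prod>j<n. expectation (\<lambda>\<omega>. normal_prob s (N_incr j \<omega>) (B j)))"
    using s A by (intro log_incr_joint) (auto simp: B_def)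
  also have "(\<Inter>j<n. {\<omega> \<in> space M. log_incr s j \<omega> \<in> B j}) = {\<omega> \<in> space M. log_incr s i \<omega> \<in> A}"
    using i by (force simp: B_def)
  also have "(\<Prod>j<n. expectation (\<lambda>\<omega>. normal_prob s (N_incr j \<omega>) (B j))) =
      (\<Prod>j<n. if j = i then expectation (\<lambda>\<omega>. normal_prob s (N_incr i \<omega>) A) else 1)"
    using normal_prob(3)[OF s] by (intro prod.cong) (auto simp: B_def prob_space)
  finally show ?thesis
    using i by simp
qed

text \<open>The factors in \<open>log_incr_joint\<close> are the marginal probabilities of
  \<open>log_incr_prob\<close>.\<close>

lemma log_incr_indep:
  assumes s: "\<And>i. i < n \<Longrightarrow> s i > 0"
  shows "indep_vars (\<lambda>_. borel) (\<lambda>i. log_incr (s i) i) {..<n}"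
proof -
  let ?F = "\<lambda>i. {log_incr (s i) i -` A \<inter> space M |A. A \<in> sets borel}"
  have "indep_sets ?F {..<n}"
  proof (subst indep_sets_finite)
    show "{..<n} \<noteq> {}"
      using pos(5) by (auto simp: lessThan_empty_iff)
    show "?F i \<subseteq> events" if "i \<in> {..<n}" for i
      using that by (auto intro: measurable_sets[OF measurable_log_incr])
    show "space M \<in> ?F i" for i
      by (auto intro!: exI[of _ UNIV])
    show "\<forall>A\<in>Pi {..<n} ?F. prob (\<Inter> (A ` {..<n})) = (\<Prod>i<n. prob (A i))"
    proof
      fix A assume A: "A \<in> Pi {..<n} ?F"
      have "\<forall>i\<in>{..<n}. \<exists>B. A i = log_incr (s i) i -` B \<inter> space M \<and> B \<in> sets borel"
        using A by (simp add: Pi_iff)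
      from bchoice[OF this] obtain B where
        "\<forall>i\<in>{..<n}. A i = log_incr (s i) i -` B i \<inter> space M \<and> B i \<in> sets borel"
        by blast
      then have B: "B i \<in> sets borel" "A i = {\<omega> \<in> space M. log_incr (s i) i \<omega> \<in> B i}" if "i < n" for i
        using that by auto
      have "prob (\<Inter> (A ` {..<n})) = prob (\<Inter>i<n. {\<omega> \<in> space M. log_incr (s i) i \<omega> \<in> B i})"
        using B(2) by simp
      also have "\<dots> = (\<Prod>i<n. expectation (\<lambda>\<omega>. normal_prob (s i) (N_incr i \<omega>) (B i)))"
        by (intro log_incr_joint s B)
      also have "\<dots> = (\<Prod>i<n. prob (A i))"
        using B s by (intro prod.cong) (auto simp: log_incr_prob)
      finally show "prob (\<Inter> (A ` {..<n})) = (\<Prod>i<n. prob (A i))" .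
    qed
  qed simp
  then show ?thesis
    unfolding indep_vars_def2 by auto
qed

lemma N_incr_law:
  "i < n \<Longrightarrow> distr M (count_space UNIV) (N_incr i) = measure_pmf (poisson_pmf (lam * \<tau>))"
  using poisson time_bounds[of i] time_bounds[of "Suc i"] pos(3) step[of i]
  unfolding poisson_process_def N_incr_def[abs_def]
  by (metis Suc_leI add_diff_cancel_left' less_add_same_cancel1 less_imp_le_nat)

lemma N_incr_expectation:
  fixes f :: "nat \<Rightarrow> real"
  assumes i: "i < n" and f: "\<And>m. \<bar>f m\<bar> \<le> C"
  shows "expectation (\<lambda>\<omega>. f (N_incr i \<omega>)) =
    exp (- lam * \<tau>) * (\<Sum>m. (lam * \<tau>) ^ m / fact m * f m)"
proof -
  let ?p = "poisson_pmf (lam * \<tau>)"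
  have "expectation (\<lambda>\<omega>. f (N_incr i \<omega>)) = (\<integral>m. f m \<partial>distr M (count_space UNIV) (N_incr i))"
    using i by (simp add: integral_distr)
  also have "\<dots> = (\<integral>m. f m \<partial>?p)"
    by (simp add: N_incr_law[OF i])
  also have "\<dots> = (\<integral>m. pmf ?p m * f m \<partial>count_space UNIV)"
    by (subst measure_pmf_eq_density, subst integral_density) auto
  also have "\<dots> = (\<Sum>m. pmf ?p m * f m)"
  proof -
    have "integrable ?p f"
      by (rule measure_pmf.integrable_const_bound[of _ C]) (use f in auto)
    then have "integrable (count_space UNIV) (\<lambda>m. pmf ?p m * f m)"
      by (subst (asm) measure_pmf_eq_density, subst (asm) integrable_density) auto
    from sums_integral_count_space_nat[OF this] show ?thesis
      by (simp add: sums_iff)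
  qed
  also have "\<dots> = (\<Sum>m. exp (- lam * \<tau>) * ((lam * \<tau>) ^ m / fact m * f m))"
    using pos by (intro suminf_cong) simp
  also have "\<dots> = exp (- lam * \<tau>) * (\<Sum>m. (lam * \<tau>) ^ m / fact m * f m)"
    using summable_weighted[of "\<lambda>m. (lam * \<tau>) ^ m / fact m" f C] poisson_weights[of "lam * \<tau>"] f pos
    by (intro suminf_mult) auto
  finally show ?thesis .
qed

lemma log_incr_cdf:
  assumes i: "i < n" and s: "s > 0" and w: "w > 0"
  shows "\<P>(\<omega> in M. exp (\<gamma> * \<tau> + log_incr s i \<omega>) \<le> w) = jump_diffusion_cdf lam \<tau> \<gamma> \<mu> \<delta> s w"
proof -
  have "exp (\<gamma> * \<tau> + x) \<le> w \<longleftrightarrow> x \<in> {..ln w - \<gamma> * \<tau>}" for x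
    using w by (simp add: ln_ge_iff[symmetric] algebra_simps)
  then have "\<P>(\<omega> in M. exp (\<gamma> * \<tau> + log_incr s i \<omega>) \<le> w) =
      expectation (\<lambda>\<omega>. normal_prob s (N_incr i \<omega>) {..ln w - \<gamma> * \<tau>})"
    using log_incr_prob[OF i s, of "{..ln w - \<gamma> * \<tau>}"] by simp
  also have "\<dots> = jump_diffusion_cdf lam \<tau> \<gamma> \<mu> \<delta> s w"
    by (subst N_incr_expectation[OF i, of _ 1])
      (use normal_prob[OF s] in \<open>auto simp: jump_diffusion_cdf_def std_arg_def normal_prob_atMost[OF s]
        cdf_std_normal_bounds\<close>)
  finally show ?thesis .
qed

end

section \<open>Differentiation of the expected positive part of a sum\<close>

context prob_space
begin

text \<open>The exceptional \<open>w\<close> are the reflections at 0 of the atoms of the law of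
  \<open>B\<close>, and a law on the reals has countably many atoms.\<close>

lemma AE_prob_eq_0:
  assumes [measurable]: "random_variable borel B"
  shows "AE w in lborel. AE \<omega> in M. B \<omega> + w \<noteq> (0 :: real)"
proof -
  interpret D: real_distribution "distr M borel B"
    by (intro real_distribution_distr) simp
  let ?S = "{x. 0 < measure (distr M borel B) {x}}"
  have "countable (uminus ` ?S)"
    using D.countable_atoms by (intro countable_image)
  then have "AE w in lborel. w \<notin> uminus ` ?S"
    by (intro AE_not_in countable_imp_null_set_lborel)
  then show ?thesis
  proof eventually_elim
    case (elim w)
    have "- w \<notin> ?S"
      using elim by (metis image_eqI minus_minus)
    then have "measure (distr M borel B) {- w} = 0"
      using measure_nonneg[of "distr M borel B" "{- w}"] by simp
    then have "prob {\<omega> \<in> space M. B \<omega> + w = 0} = 0"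
      by (simp add: measure_distr vimage_def Int_def conj_commute eq_neg_iff_add_eq_0)
    then show ?case
      by (subst (asm) prob_eq_0) auto
  qed
qed

lemma measurable_prob_shift [measurable]:
  assumes [measurable]: "random_variable borel B"
  shows "(\<lambda>w :: real. \<P>(\<omega> in M. 0 < B \<omega> + w)) \<in> borel_measurable borel"
  by (intro borel_measurable_mono monoI finite_measure_mono) auto

text \<open>The indicator of the positive half-line is continuous except at 0, a value the limit
  almost surely avoids.\<close>

lemma tendsto_prob_pos:
  fixes B :: "nat \<Rightarrow> 'a \<Rightarrow> real"
  assumes [measurable]: "\<And>j. random_variable borel (B j)" "random_variable borel B'"
    and lim: "\<And>\<omega>. \<omega> \<in> space M \<Longrightarrow> (\<lambda>j. B j \<omega>) \<longlonglongrightarrow> B' \<omega>"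
    and nz: "AE \<omega> in M. B' \<omega> \<noteq> 0"
  shows "(\<lambda>j. \<P>(\<omega> in M. 0 < B j \<omega>)) \<longlonglongrightarrow> \<P>(\<omega> in M. 0 < B' \<omega>)"
proof -
  have "(\<lambda>j. \<integral>\<omega>. indicator {\<omega> \<in> space M. 0 < B j \<omega>} \<omega> \<partial>M) \<longlonglongrightarrow>
      (\<integral>\<omega>. indicator {\<omega> \<in> space M. 0 < B' \<omega>} \<omega> \<partial>M :: real)"
  proof (rule integral_dominated_convergence[where w = "\<lambda>_. 1"])
    show "AE \<omega> in M. (\<lambda>j. indicator {\<omega> \<in> space M. 0 < B j \<omega>} \<omega> :: real) \<longlonglongrightarrow> indicator {\<omega> \<in> space M. 0 < B' \<omega>} \<omega>"
      using nz
    proof (rule AE_mp, intro AE_I2 impI)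
      fix \<omega> assume \<omega>: "\<omega> \<in> space M" and "B' \<omega> \<noteq> 0"
      then have "eventually (\<lambda>j. 0 < B j \<omega> \<longleftrightarrow> 0 < B' \<omega>) sequentially"
        using order_tendstoD[OF lim[OF \<omega>], of 0]
        by (cases "0 < B' \<omega>") (auto elim: eventually_mono)
      then show "(\<lambda>j. indicator {\<omega> \<in> space M. 0 < B j \<omega>} \<omega> :: real) \<longlonglongrightarrow> indicator {\<omega> \<in> space M. 0 < B' \<omega>} \<omega>"
        using \<omega> by (intro tendsto_eventually) (auto elim!: eventually_mono simp: indicator_def)
    qed
  qed (auto simp: indicator_def)
  then show ?thesis
    by simp
qed

text \<open>Only the common distribution function \<open>F\<close> is differentiated; the variables
  themselves are merely continuous in the parameter. \<open>cdf\<close> stops short of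
  \<open>L\<close>, where a cap may place an atom.\<close>

lemma pos_part_sum_has_derivative:
  fixes U :: "nat \<Rightarrow> real \<Rightarrow> 'a \<Rightarrow> real" and F :: "real \<Rightarrow> real \<Rightarrow> real" and a L C :: real
  assumes range: "\<And>i s \<omega>. \<omega> \<in> space M \<Longrightarrow> U i s \<omega> \<in> {0..L}"
    and cont: "\<And>i \<omega>. isCont (\<lambda>s. U i s \<omega>) \<sigma>"
    and indep: "\<And>s. (\<And>i. i < n \<Longrightarrow> 0 < s i) \<Longrightarrow> indep_vars (\<lambda>_. borel) (\<lambda>i. U i (s i)) {..<n}"
    and cdf: "\<And>i s w. i < n \<Longrightarrow> 0 < s \<Longrightarrow> 0 < w \<Longrightarrow> w < L \<Longrightarrow> \<P>(\<omega> in M. U i s \<omega> \<le> w) = F s w"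
    and F_meas [measurable]: "\<And>s. F s \<in> borel_measurable borel" "F' \<in> borel_measurable borel"
    and F_bound: "\<And>s w. 0 < s \<Longrightarrow> \<bar>F s w\<bar> \<le> 1"
    and deriv: "\<And>w. ((\<lambda>s. F s w) has_real_derivative F' w) (at \<sigma>)"
    and lip: "\<And>s w. s > \<sigma> / 2 \<Longrightarrow> \<bar>F s w - F \<sigma> w\<bar> \<le> C * \<bar>s - \<sigma>\<bar>"
    and "\<sigma> > 0" "0 \<le> L"
  shows "((\<lambda>s. expectation (\<lambda>\<omega>. max 0 (a + (\<Sum>i<n. U i s \<omega>)))) has_real_derivative
    - (\<Sum>k<n. LBINT w:{0<..L}. F' w * \<P>(\<omega> in M. 0 < a + (\<Sum>i\<in>{..<n} - {k}. U i \<sigma> \<omega>) + w))) (at \<sigma>)"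
proof -
  \<comment> \<open>Hybrids: the periods before \<open>k\<close> are already at \<open>s\<close>,
    the others still at \<sigma>. Both \<open>H k s\<close> and \<open>H (Suc k) s\<close> consist
    of \<open>B k s\<close> plus period \<open>k\<close>, so their difference isolates that
    period.\<close>
  define H where "H k s = expectation (\<lambda>\<omega>. max 0 (a + (\<Sum>i<n. U i (if i < k then s else \<sigma>) \<omega>)))" for k s
  define B where "B k s \<omega> = a + (\<Sum>i\<in>{..<n} - {k}. U i (if i < k then s else \<sigma>) \<omega>)" for k s \<omega>
  have U [measurable]: "random_variable borel (U i s)" if "i < n" "s > 0" for i s
    using indep[of "\<lambda>_. s"] that by (auto simp: indep_vars_def)
  have B_meas [measurable]: "random_variable borel (B k s)" if "s > 0" for k s
    unfolding B_def[abs_def] using that \<open>\<sigma> > 0\<close>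
    by (intro borel_measurable_add borel_measurable_sum) (auto intro: U)
  have B_bound: "\<bar>B k s \<omega>\<bar> \<le> \<bar>a\<bar> + (\<Sum>i\<in>{..<n} - {k}. L)" if "\<omega> \<in> space M" for k s \<omega>
  proof -
    have "\<bar>\<Sum>i\<in>{..<n} - {k}. U i (if i < k then s else \<sigma>) \<omega>\<bar> \<le> (\<Sum>i\<in>{..<n} - {k}. L)"
      using range[OF that] by (intro order_trans[OF sum_abs sum_mono]) auto
    then show ?thesis
      unfolding B_def by linarith
  qed
  have layer: "expectation (\<lambda>\<omega>. max 0 (B k s \<omega> + U k s' \<omega>)) = expectation (\<lambda>\<omega>. max 0 (B k s \<omega> + L)) -
      (LBINT w:{0<..L}. F s' w * \<P>(\<omega> in M. 0 < B k s \<omega> + w))"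
    if k: "k < n" and s: "s > 0" "s' > 0" for k s s'
  proof -
    define v where "v i = (if i = k then s' else if i < k then s else \<sigma>)" for i
    have "indep_vars (\<lambda>_. borel) (\<lambda>i. U i (v i)) (insert k ({..<n} - {k}))"
      using k s \<open>\<sigma> > 0\<close> indep[of v] by (simp add: v_def insert_absorb)
    then have "indep_var borel (U k (v k)) borel (\<lambda>\<omega>. \<Sum>i\<in>{..<n} - {k}. U i (v i) \<omega>)"
      by (intro indep_vars_sum) auto
    then have "indep_var borel ((\<lambda>x. x) \<circ> U k (v k)) borel ((\<lambda>x. a + x) \<circ> (\<lambda>\<omega>. \<Sum>i\<in>{..<n} - {k}. U i (v i) \<omega>))"
      by (rule indep_var_compose) auto
    moreover have "(\<lambda>x. a + x) \<circ> (\<lambda>\<omega>. \<Sum>i\<in>{..<n} - {k}. U i (v i) \<omega>) = B k s"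
      by (auto simp: B_def v_def fun_eq_iff intro!: sum.cong)
    ultimately have "indep_var borel (U k s') borel (B k s)"
      by (simp add: o_def v_def)
    then have "expectation (\<lambda>\<omega>. max 0 (B k s \<omega> + U k s' \<omega>)) = expectation (\<lambda>\<omega>. max 0 (B k s \<omega> + L)) -
        (LBINT w:{0<..L}. \<P>(\<omega> in M. U k s' \<omega> \<le> w) * \<P>(\<omega> in M. 0 < B k s \<omega> + w))"
      by (rule expectation_pos_part_indep) (use range B_bound in auto)
    also have "(LBINT w:{0<..L}. \<P>(\<omega> in M. U k s' \<omega> \<le> w) * \<P>(\<omega> in M. 0 < B k s \<omega> + w)) =
        (LBINT w:{0<..L}. F s' w * \<P>(\<omega> in M. 0 < B k s \<omega> + w))"
      unfolding set_lebesgue_integral_def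
    proof (rule integral_cong_AE)
      have [measurable]: "(\<lambda>w. \<P>(\<omega> in M. U k s' \<omega> \<le> w)) \<in> borel_measurable borel"
        using k s by (intro borel_measurable_mono monoI finite_measure_mono) auto
      have [measurable]: "random_variable borel (B k s)"
        using s by simp
      show "(\<lambda>w. indicat_real {0<..L} w *\<^sub>R (\<P>(\<omega> in M. U k s' \<omega> \<le> w) * \<P>(\<omega> in M. 0 < B k s \<omega> + w)))
          \<in> borel_measurable lborel"
        "(\<lambda>w. indicat_real {0<..L} w *\<^sub>R (F s' w * \<P>(\<omega> in M. 0 < B k s \<omega> + w))) \<in> borel_measurable lborel"
        by measurable
      \<comment> \<open>\<open>F\<close> is known to be the distribution function only for
        \<open>w < L\<close>; the end point is a null set.\<close>
      show "AE w in lborel. indicat_real {0<..L} w *\<^sub>R (\<P>(\<omega> in M. U k s' \<omega> \<le> w) * \<P>(\<omega> in M. 0 < B k s \<omega> + w)) =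
          indicat_real {0<..L} w *\<^sub>R (F s' w * \<P>(\<omega> in M. 0 < B k s \<omega> + w))"
        using AE_lborel_singleton[of L]
        by eventually_elim (use cdf[OF k s(2)] in \<open>auto simp: indicator_def\<close>)
    qed
    finally show ?thesis .
  qed
  have integrable: "set_integrable lborel {0<..L} (\<lambda>w. F s' w * \<P>(\<omega> in M. 0 < B k s \<omega> + w))"
    if s: "s > 0" "s' > 0" for k s s'
    unfolding set_integrable_def
  proof (rule Bochner_Integration.integrable_bound)
    show "integrable lborel (indicator {0<..L} :: real \<Rightarrow> real)"
      using \<open>0 \<le> L\<close> by auto
    have [measurable]: "random_variable borel (B k s)"
      using s by simp
    show "(\<lambda>w. indicat_real {0<..L} w *\<^sub>R (F s' w * \<P>(\<omega> in M. 0 < B k s \<omega> + w))) \<in> borel_measurable lborel"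
      by measurable
    show "AE w in lborel. norm (indicat_real {0<..L} w *\<^sub>R (F s' w * \<P>(\<omega> in M. 0 < B k s \<omega> + w)))
        \<le> norm (indicat_real {0<..L} w)"
      using F_bound[OF s(2)] by (auto simp: abs_mult indicator_def intro!: mult_le_one AE_I2)
  qed
  have diff: "(H (Suc k) s - H k s) / (s - \<sigma>) =
      - (LBINT w:{0<..L}. (F s w - F \<sigma> w) / (s - \<sigma>) * \<P>(\<omega> in M. 0 < B k s \<omega> + w))"
    if k: "k < n" and s: "s > 0" for k s
  proof -
    have split: "(\<Sum>i<n. f i) = f k + (\<Sum>i\<in>{..<n} - {k}. f i)" for f :: "nat \<Rightarrow> real"
      using k by (intro sum.remove) auto
    have "H (Suc k) s = expectation (\<lambda>\<omega>. max 0 (B k s \<omega> + U k s \<omega>))"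
      unfolding H_def B_def
      by (subst split) (auto intro!: Bochner_Integration.integral_cong arg_cong[where f = "max 0"] sum.cong simp: add_ac less_Suc_eq)
    moreover have "H k s = expectation (\<lambda>\<omega>. max 0 (B k s \<omega> + U k \<sigma> \<omega>))"
      unfolding H_def B_def
      by (subst split) (auto intro!: Bochner_Integration.integral_cong arg_cong[where f = "max 0"] sum.cong simp: add_ac)
    ultimately have "H (Suc k) s - H k s = - ((LBINT w:{0<..L}. F s w * \<P>(\<omega> in M. 0 < B k s \<omega> + w)) -
        (LBINT w:{0<..L}. F \<sigma> w * \<P>(\<omega> in M. 0 < B k s \<omega> + w)))"
      using layer[OF k s s] layer[OF k s \<open>\<sigma> > 0\<close>] by simp
    also have "\<dots> = - (LBINT w:{0<..L}. F s w * \<P>(\<omega> in M. 0 < B k s \<omega> + w) - F \<sigma> w * \<P>(\<omega> in M. 0 < B k s \<omega> + w))"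
      by (subst set_integral_diff) (use integrable s \<open>\<sigma> > 0\<close> in auto)
    finally have "(H (Suc k) s - H k s) / (s - \<sigma>) =
        - ((LBINT w:{0<..L}. F s w * \<P>(\<omega> in M. 0 < B k s \<omega> + w) - F \<sigma> w * \<P>(\<omega> in M. 0 < B k s \<omega> + w)) / (s - \<sigma>))"
      by simp
    also have "\<dots> = - (LBINT w:{0<..L}. (F s w * \<P>(\<omega> in M. 0 < B k s \<omega> + w) -
        F \<sigma> w * \<P>(\<omega> in M. 0 < B k s \<omega> + w)) / (s - \<sigma>))"
      by simp
    also have "\<dots> = - (LBINT w:{0<..L}. (F s w - F \<sigma> w) / (s - \<sigma>) * \<P>(\<omega> in M. 0 < B k s \<omega> + w))"
      by (simp add: diff_divide_distrib left_diff_distrib)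
    finally show ?thesis .
  qed
  \<comment> \<open>The restriction to \<open>{\<sigma> / 2<..}\<close> keeps volatilities positive
    and within the range of \<open>lip\<close>; being a neighbourhood of \<sigma>, it disappears
    through \<open>at_eq\<close>.\<close>
  have term_lim: "((\<lambda>s. LBINT w:{0<..L}. (F s w - F \<sigma> w) / (s - \<sigma>) * \<P>(\<omega> in M. 0 < B k s \<omega> + w)) \<longlongrightarrow>
      (LBINT w:{0<..L}. F' w * \<P>(\<omega> in M. 0 < B k \<sigma> \<omega> + w))) (at \<sigma> within {\<sigma> / 2<..})"
    if k: "k < n" for k
  proof (subst tendsto_at_iff_sequentially, intro allI impI, unfold o_def)
    fix X :: "nat \<Rightarrow> real"
    assume X: "\<forall>j. X j \<in> {\<sigma> / 2<..} - {\<sigma>}" "X \<longlonglongrightarrow> \<sigma>"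
    then have X_pos: "X j > 0" and X_half: "X j > \<sigma> / 2" and X_ne: "X j \<noteq> \<sigma>" for j
      using \<open>\<sigma> > 0\<close> by (auto intro: less_trans[of 0 "\<sigma> / 2"])
    have [measurable]: "random_variable borel (B k (X j))" "random_variable borel (B k \<sigma>)" for j
      using X_pos \<open>\<sigma> > 0\<close> by simp_all
    show "(\<lambda>j. LBINT w:{0<..L}. (F (X j) w - F \<sigma> w) / (X j - \<sigma>) * \<P>(\<omega> in M. 0 < B k (X j) \<omega> + w)) \<longlonglongrightarrow>
        (LBINT w:{0<..L}. F' w * \<P>(\<omega> in M. 0 < B k \<sigma> \<omega> + w))"
      unfolding set_lebesgue_integral_def
    proof (rule integral_dominated_convergence[where w = "\<lambda>w. indicator {0<..L} w * C"])
      show "integrable lborel (\<lambda>w. indicator {0<..L} w * C)"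
        using \<open>0 \<le> L\<close> by (intro integrable_mult_left) auto
      show "AE w in lborel. norm (indicat_real {0<..L} w *\<^sub>R
          ((F (X j) w - F \<sigma> w) / (X j - \<sigma>) * \<P>(\<omega> in M. 0 < B k (X j) \<omega> + w))) \<le> indicator {0<..L} w * C" for j
      proof (rule AE_I2)
        fix w
        have "\<bar>(F (X j) w - F \<sigma> w) / (X j - \<sigma>)\<bar> \<le> C"
          using lip[OF X_half[of j], of w] X_ne[of j] by (simp add: field_simps)
        moreover from this have "0 \<le> C"
          by (rule order_trans[OF abs_ge_zero])
        ultimately have "\<bar>(F (X j) w - F \<sigma> w) / (X j - \<sigma>)\<bar> * \<P>(\<omega> in M. 0 < B k (X j) \<omega> + w) \<le> C * 1"
          by (intro mult_mono) auto
        then show "norm (indicat_real {0<..L} w *\<^sub>R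
          ((F (X j) w - F \<sigma> w) / (X j - \<sigma>) * \<P>(\<omega> in M. 0 < B k (X j) \<omega> + w))) \<le> indicator {0<..L} w * C"
          by (auto simp: indicator_def abs_mult)
      qed
      show "AE w in lborel. (\<lambda>j. indicat_real {0<..L} w *\<^sub>R
          ((F (X j) w - F \<sigma> w) / (X j - \<sigma>) * \<P>(\<omega> in M. 0 < B k (X j) \<omega> + w))) \<longlonglongrightarrow>
          indicat_real {0<..L} w *\<^sub>R (F' w * \<P>(\<omega> in M. 0 < B k \<sigma> \<omega> + w))"
        using AE_prob_eq_0[OF B_meas[OF \<open>\<sigma> > 0\<close>, of k]]
      proof eventually_elim
        case (elim w)
        have "((\<lambda>s. (F s w - F \<sigma> w) / (s - \<sigma>)) \<longlongrightarrow> F' w) (at \<sigma>)"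
          using deriv[of w] by (simp add: has_field_derivative_iff)
        then have "(\<lambda>j. (F (X j) w - F \<sigma> w) / (X j - \<sigma>)) \<longlonglongrightarrow> F' w"
        proof (rule filterlim_compose)
          show "filterlim X (at \<sigma>) sequentially"
            using X(2) X_ne by (simp add: filterlim_at)
        qed
        \<comment> \<open>The periods before \<open>k\<close> move along with \<open>X j\<close>.
          For almost every \<open>w\<close> the limit variable has no mass at the discontinuity of
          the indicator.\<close>
        moreover have "(\<lambda>j. \<P>(\<omega> in M. 0 < B k (X j) \<omega> + w)) \<longlonglongrightarrow> \<P>(\<omega> in M. 0 < B k \<sigma> \<omega> + w)"
        proof (rule tendsto_prob_pos)
          fix \<omega>
          have "(\<lambda>j. U i (if i < k then X j else \<sigma>) \<omega>) \<longlonglongrightarrow> U i (if i < k then \<sigma> else \<sigma>) \<omega>" for i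
            using isCont_tendsto_compose[OF cont X(2), of i \<omega>] by (cases "i < k") auto
          then show "(\<lambda>j. B k (X j) \<omega> + w) \<longlonglongrightarrow> B k \<sigma> \<omega> + w"
            unfolding B_def by (intro tendsto_intros)
        qed (use elim in auto)
        ultimately show ?case
          by (intro tendsto_intros)
      qed
    qed measurable
  qed
  have at_eq: "at \<sigma> within {\<sigma> / 2<..} = at \<sigma>"
    using \<open>\<sigma> > 0\<close> by (intro at_within_open) auto
  have "((\<lambda>s. \<Sum>k<n. - (LBINT w:{0<..L}. (F s w - F \<sigma> w) / (s - \<sigma>) * \<P>(\<omega> in M. 0 < B k s \<omega> + w))) \<longlongrightarrow>
      (\<Sum>k<n. - (LBINT w:{0<..L}. F' w * \<P>(\<omega> in M. 0 < B k \<sigma> \<omega> + w)))) (at \<sigma> within {\<sigma> / 2<..})"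
    by (intro tendsto_sum tendsto_minus term_lim) simp
  moreover have "eventually (\<lambda>s. (\<Sum>k<n. - (LBINT w:{0<..L}. (F s w - F \<sigma> w) / (s - \<sigma>) *
      \<P>(\<omega> in M. 0 < B k s \<omega> + w))) = (H n s - H n \<sigma>) / (s - \<sigma>)) (at \<sigma> within {\<sigma> / 2<..})"
  proof -
    have "eventually (\<lambda>s. s > \<sigma> / 2) (at \<sigma> within {\<sigma> / 2<..})"
      by (auto simp: eventually_at_filter)
    then show ?thesis
    proof eventually_elim
      case (elim s)
      then have "s > 0"
        using \<open>\<sigma> > 0\<close> by simp
      have "(\<Sum>k<n. - (LBINT w:{0<..L}. (F s w - F \<sigma> w) / (s - \<sigma>) * \<P>(\<omega> in M. 0 < B k s \<omega> + w))) =
          (\<Sum>k<n. (H (Suc k) s - H k s) / (s - \<sigma>))"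
        using diff[OF _ \<open>s > 0\<close>] by simp
      also have "\<dots> = (H n s - H 0 s) / (s - \<sigma>)"
        using sum_lessThan_telescope[of "\<lambda>k. H k s" n] by (simp flip: sum_divide_distrib)
      \<comment> \<open>No period moved to \<open>s\<close>, or all moved to \<sigma>: either way
        every period is at \<sigma>.\<close>
      also have "H 0 s = H n \<sigma>"
        by (simp add: H_def)
      finally show ?case .
    qed
  qed
  ultimately have "((\<lambda>s. (H n s - H n \<sigma>) / (s - \<sigma>)) \<longlongrightarrow>
      (\<Sum>k<n. - (LBINT w:{0<..L}. F' w * \<P>(\<omega> in M. 0 < B k \<sigma> \<omega> + w)))) (at \<sigma>)"
    unfolding at_eq by (rule Lim_transform_eventually)
  then have "(H n has_real_derivative
      (\<Sum>k<n. - (LBINT w:{0<..L}. F' w * \<P>(\<omega> in M. 0 < B k \<sigma> \<omega> + w)))) (at \<sigma>)"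
    by (simp add: has_field_derivative_iff)
  moreover have "H n = (\<lambda>s. expectation (\<lambda>\<omega>. max 0 (a + (\<Sum>i<n. U i s \<omega>))))"
    by (simp add: H_def fun_eq_iff)
  moreover have "B k \<sigma> \<omega> = a + (\<Sum>i\<in>{..<n} - {k}. U i \<sigma> \<omega>)" for k \<omega>
    by (simp add: B_def)
  ultimately show ?thesis
    by (simp add: sum_negf)
qed

end

section \<open>The cliquet option\<close>

lemma set_integrable_bounded:
  fixes f :: "real \<Rightarrow> 'b::{banach, second_countable_topology}"
  assumes [measurable]: "f \<in> borel_measurable borel"
    and bound: "\<And>w. norm (f w) \<le> C"
  shows "set_integrable lborel {a<..b} f"
  unfolding set_integrable_def
proof (rule Bochner_Integration.integrable_bound)
  have "integrable lborel (indicator {a<..b} :: real \<Rightarrow> real)"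
    by (cases "a \<le> b") auto
  then show "integrable lborel (\<lambda>w. indicator {a<..b} w * C)"
    by (rule integrable_mult_left)
  show "AE w in lborel. norm (indicat_real {a<..b} w *\<^sub>R f w) \<le> norm (indicat_real {a<..b} w * C)"
    using order_trans[OF norm_ge_zero bound] bound by (auto simp: indicator_def intro!: AE_I2)
qed simp

lemma set_integral_mult_right_zero:
  fixes a :: "'b::{real_normed_field, second_countable_topology}"
  shows "(LINT x:A|M. a * f x) = a * (LINT x:A|M. f x)"
  unfolding set_lebesgue_integral_def mult_scaleR_right[symmetric] by (rule integral_mult_right_zero)

text \<open>The uniform bound and the finite length of the interval give the summable majorant
  \<open>p m * (C * (b - a))\<close>.\<close>

lemma set_integral_weighted_series:
  fixes p :: "nat \<Rightarrow> real" and f :: "nat \<Rightarrow> real \<Rightarrow> 'b::{real_normed_field, banach, second_countable_topology}"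
  assumes p: "summable p" "\<And>m. 0 \<le> p m"
    and [measurable]: "\<And>m. f m \<in> borel_measurable borel"
    and bound: "\<And>m w. norm (f m w) \<le> C"
    and "a \<le> b"
  shows "summable (\<lambda>m. of_real (p m) * (LINT w:{a<..b}|lborel. f m w))"
    and "(LINT w:{a<..b}|lborel. (\<Sum>m. of_real (p m) * f m w)) =
      (\<Sum>m. of_real (p m) * (LINT w:{a<..b}|lborel. f m w))"
proof -
  have int: "set_integrable lborel {a<..b} (f m)" for m
    by (rule set_integrable_bounded[OF _ bound]) simp
  have norm_int: "(\<integral>w. norm (indicat_real {a<..b} w *\<^sub>R f m w) \<partial>lborel) \<le> C * (b - a)" for m
  proof -
    have "(\<integral>w. norm (indicat_real {a<..b} w *\<^sub>R f m w) \<partial>lborel) \<le> (\<integral>w. indicat_real {a<..b} w * C \<partial>lborel)"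
    proof (rule integral_mono)
      show "integrable lborel (\<lambda>w. norm (indicat_real {a<..b} w *\<^sub>R f m w))"
        using int[of m] unfolding set_integrable_def by (rule integrable_norm)
      show "integrable lborel (\<lambda>w. indicat_real {a<..b} w * C)"
        using \<open>a \<le> b\<close> by (intro integrable_mult_left) auto
      show "norm (indicat_real {a<..b} w *\<^sub>R f m w) \<le> indicat_real {a<..b} w * C" for w
        using bound by (auto simp: indicator_def)
    qed
    then show ?thesis
      using \<open>a \<le> b\<close> by (simp add: mult.commute)
  qed
  show "summable (\<lambda>m. of_real (p m) * (LINT w:{a<..b}|lborel. f m w))"
    unfolding set_lebesgue_integral_def
    by (rule summable_weighted[OF p order_trans[OF integral_norm_bound norm_int]])
  have "(\<integral>w. (\<Sum>m. of_real (p m) * (indicat_real {a<..b} w *\<^sub>R f m w)) \<partial>lborel) =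
      (\<Sum>m. \<integral>w. of_real (p m) * (indicat_real {a<..b} w *\<^sub>R f m w) \<partial>lborel)"
  proof (rule integral_suminf)
    show "integrable lborel (\<lambda>w. of_real (p m) * (indicat_real {a<..b} w *\<^sub>R f m w))" for m
      using int[of m] unfolding set_integrable_def by (rule integrable_mult_right)
    show "AE w in lborel. summable (\<lambda>m. norm (of_real (p m) * (indicat_real {a<..b} w *\<^sub>R f m w)))"
    proof (rule AE_I2, rule summable_comparison_test'[of "\<lambda>m. p m * C" 0])
      show "summable (\<lambda>m. p m * C)"
        using p by (intro summable_mult2)
      show "norm (norm (of_real (p m) * (indicat_real {a<..b} w *\<^sub>R f m w))) \<le> p m * C" for m w
        using p(2)[of m] bound[of m w] order_trans[OF norm_ge_zero bound[of m w]]
        by (auto simp: norm_mult indicator_def intro!: mult_left_mono)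
    qed
    show "summable (\<lambda>m. \<integral>w. norm (of_real (p m) * (indicat_real {a<..b} w *\<^sub>R f m w)) \<partial>lborel)"
    proof (rule summable_comparison_test'[of "\<lambda>m. p m * (C * (b - a))" 0])
      show "summable (\<lambda>m. p m * (C * (b - a)))"
        using p by (intro summable_mult2)
      show "norm (\<integral>w. norm (of_real (p m) * (indicat_real {a<..b} w *\<^sub>R f m w)) \<partial>lborel) \<le> p m * (C * (b - a))" for m
      proof -
        have eq: "norm (of_real (p m) * (indicat_real {a<..b} w *\<^sub>R f m w)) =
            p m * norm (indicat_real {a<..b} w *\<^sub>R f m w)" for w
          unfolding norm_mult by (simp add: p(2))
        have "0 \<le> (\<integral>w. norm (indicat_real {a<..b} w *\<^sub>R f m w) \<partial>lborel)"
          by (rule Bochner_Integration.integral_nonneg) (rule norm_ge_zero)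
        then show ?thesis
          unfolding eq integral_mult_right_zero real_norm_def abs_mult using p(2)[of m] norm_int[of m]
          by (simp only: abs_of_nonneg mult_left_mono)
      qed
    qed
  qed
  moreover have "(\<Sum>m. of_real (p m) * (indicat_real {a<..b} w *\<^sub>R f m w)) =
      indicat_real {a<..b} w *\<^sub>R (\<Sum>m. of_real (p m) * f m w)" for w
    by (simp add: indicator_def)
  ultimately show "(LINT w:{a<..b}|lborel. (\<Sum>m. of_real (p m) * f m w)) =
      (\<Sum>m. of_real (p m) * (LINT w:{a<..b}|lborel. f m w))"
    unfolding set_lebesgue_integral_def by (simp only: integral_mult_right_zero)
qed

lemma jump_diffusion_cdf_abs_le_1:
  assumes "lam \<ge> 0" "\<tau> > 0"
  shows "\<bar>jump_diffusion_cdf lam \<tau> \<gamma> \<mu> \<delta> s w\<bar> \<le> 1"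
proof -
  let ?p = "\<lambda>m. (lam * \<tau>) ^ m / fact m"
  let ?f = "\<lambda>m. cdf std_normal_distribution (std_arg \<tau> \<gamma> s \<mu> \<delta> m w)"
  note p = poisson_weights[of "lam * \<tau>"]
  have s: "summable (\<lambda>m. ?p m * ?f m)"
    using summable_weighted[of ?p ?f 1] p cdf_std_normal_bounds assms by simp
  have "(\<Sum>m. ?p m * ?f m) \<le> (\<Sum>m. ?p m)"
  proof (rule suminf_le)
    show "?p m * ?f m \<le> ?p m" for m
      using p(2)[of m] cdf_std_normal_bounds assms by (intro mult_left_le) auto
  qed (use s p assms in auto)
  then have "exp (- lam * \<tau>) * (\<Sum>m. ?p m * ?f m) \<le> exp (- lam * \<tau>) * exp (lam * \<tau>)"
    using p assms by (intro mult_left_mono) auto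
  moreover have "0 \<le> (\<Sum>m. ?p m * ?f m)"
    using p cdf_std_normal_bounds assms by (intro suminf_nonneg s) auto
  ultimately show ?thesis
    by (simp add: jump_diffusion_cdf_def exp_minus abs_mult)
qed

section \<open>Capped growth factors and the price\<close>

locale cliquet_market = jump_drivers +
  fixes S0 \<gamma> c g :: real
  assumes S0: "S0 > 0" and cap: "c \<ge> 0"
begin

text \<open>Almost surely one plus the capped return. The shift makes the variable nonnegative, so
  that the layer-cake integrals start at 0. Periods are numbered from 0 here and from 1 in the
  payoff.\<close>

definition capped_growth :: "nat \<Rightarrow> real \<Rightarrow> 'a \<Rightarrow> real" where
  "capped_growth i s \<omega> = min (1 + c) (exp (\<gamma> * \<tau> + log_incr s i \<omega>))"

lemma capped_growth_range: "capped_growth i s \<omega> \<in> {0..1 + c}"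
  using cap by (simp add: capped_growth_def min_def)

lemma measurable_capped_growth [measurable]: "i < n \<Longrightarrow> random_variable borel (capped_growth i s)"
  unfolding capped_growth_def[abs_def] by measurable

lemma capped_growth_indep:
  assumes "\<And>i. i < n \<Longrightarrow> 0 < s i"
  shows "indep_vars (\<lambda>_. borel) (\<lambda>i. capped_growth i (s i)) {..<n}"
  unfolding capped_growth_def[abs_def]
  by (rule indep_vars_compose2[OF log_incr_indep[OF assms]]) auto

lemma capped_growth_isCont: "isCont (\<lambda>s. capped_growth i s \<omega>) \<sigma>"
  unfolding isCont_def capped_growth_def log_incr_def by (intro tendsto_intros)

text \<open>Below \<open>1 + c\<close> the cap is invisible to the distribution function.\<close>

lemma capped_growth_cdf:
  assumes "i < n" "0 < s" "0 < w" "w < 1 + c"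
  shows "\<P>(\<omega> in M. capped_growth i s \<omega> \<le> w) = jump_diffusion_cdf lam \<tau> \<gamma> \<mu> \<delta> s w"
  using log_incr_cdf[OF assms(1,2,3), of \<gamma>] assms(4)
  by (simp add: capped_growth_def min_le_iff_disj not_le[symmetric])

text \<open>In the price ratio \<open>S0\<close> and all contributions up to the earlier date
  cancel. Splitting the jump sum at that date requires nondecreasing counts, hence "almost
  surely".\<close>

lemma AE_period_return:
  "AE \<omega> in M. \<forall>i<n. min c (period_return W N Y S0 \<gamma> s t (Suc i) \<omega>) = capped_growth i s \<omega> - 1"
  using AE_mono_counts
proof eventually_elim
  case (elim \<omega>)
  show ?case
  proof (intro allI impI)
    fix i assume i: "i < n"
    have "{1..N (t (Suc i)) \<omega>} = {1..N (t i) \<omega>} \<union> {N (t i) \<omega><..N (t (Suc i)) \<omega>}"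
      using elim i by auto
    then have "(\<Sum>j=1..N (t (Suc i)) \<omega>. Y j \<omega>) = (\<Sum>j=1..N (t i) \<omega>. Y j \<omega>) + log_jump i \<omega>"
      unfolding log_jump_def by (subst sum.union_disjoint[symmetric]) auto
    then have "jump_diffusion W N Y \<gamma> s (t (Suc i)) \<omega> - jump_diffusion W N Y \<gamma> s (t i) \<omega> =
        \<gamma> * \<tau> + log_incr s i \<omega>"
      using step[OF i] by (simp add: jump_diffusion_def log_incr_def W_incr_def algebra_simps)
    then have "period_return W N Y S0 \<gamma> s t (Suc i) \<omega> = exp (\<gamma> * \<tau> + log_incr s i \<omega>) - 1"
      using S0 by (simp add: period_return_def stock_price_def exp_diff[symmetric])
    then show "min c (period_return W N Y S0 \<gamma> s t (Suc i) \<omega>) = capped_growth i s \<omega> - 1"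
      by (simp add: capped_growth_def min_def)
  qed
qed

lemma measurable_jump_diffusion:
  assumes "i \<le> n"
  shows "random_variable borel (jump_diffusion W N Y \<gamma> s (t i))"
proof -
  have "(\<lambda>\<omega>. \<Sum>j=1..m. Y j \<omega>) \<in> borel_measurable M" for m
    by (intro borel_measurable_sum measurable_Y) auto
  then have [measurable]: "(\<lambda>\<omega>. \<Sum>j=1..N (t i) \<omega>. Y j \<omega>) \<in> borel_measurable M"
    by (rule measurable_compose_countable[where f = "\<lambda>m \<omega>. \<Sum>j=1..m. Y j \<omega>"]) (use assms in simp)
  have [measurable]: "random_variable borel (W (t i))"
    using assms by simp
  show ?thesis
    unfolding jump_diffusion_def[abs_def] by measurable
qed

lemma measurable_period_return:
  "i < n \<Longrightarrow> random_variable borel (period_return W N Y S0 \<gamma> s t (Suc i))"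
  unfolding period_return_def[abs_def] stock_price_def
  by (intro borel_measurable_diff borel_measurable_divide borel_measurable_times
      borel_measurable_const borel_measurable_exp measurable_compose[OF measurable_jump_diffusion]
      measurable_compose[OF _ borel_measurable_exp] measurable_jump_diffusion) auto

text \<open>From max g x = g + max 0 (x - g); the \<open>n\<close> shifts by one in
  \<open>capped_growth\<close> account for \<open>- real n\<close>.\<close>

lemma cliquet_price_eq:
  "cliquet_price M W N Y S0 r T \<gamma> s t n K g c =
    exp (- r * T) * (K + K * (g + expectation (\<lambda>\<omega>. max 0 (- real n - g + (\<Sum>i<n. capped_growth i s \<omega>)))))"
proof -
  let ?G = "\<lambda>\<omega>. max 0 (- real n - g + (\<Sum>i<n. capped_growth i s \<omega>))"
  have sum_shift: "(\<Sum>k=1..n. f k) = (\<Sum>i<n. f (Suc i))" for f :: "nat \<Rightarrow> real"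
    by (simp add: sum.atLeast1_atMost_eq)
  have sum_bound: "\<bar>\<Sum>i<n. capped_growth i s \<omega>\<bar> \<le> (\<Sum>i<n. 1 + c)" for \<omega>
    using capped_growth_range by (intro order_trans[OF sum_abs sum_mono]) auto
  have "\<bar>?G \<omega>\<bar> \<le> real n + \<bar>g\<bar> + (\<Sum>i<n. 1 + c)" for \<omega>
    using sum_bound[of \<omega>] by (auto simp: max_def)
  then have int: "integrable M ?G"
    by (intro integrable_const_bound[of _ "real n + \<bar>g\<bar> + (\<Sum>i<n. 1 + c)"] AE_I2) (auto intro!:
        borel_measurable_max borel_measurable_add borel_measurable_sum)
  have "expectation (\<lambda>\<omega>. cliquet_payoff W N Y S0 \<gamma> s t n K g c \<omega>) = expectation (\<lambda>\<omega>. K + K * (g + ?G \<omega>))"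
  proof (rule integral_cong_AE)
    show "(\<lambda>\<omega>. cliquet_payoff W N Y S0 \<gamma> s t n K g c \<omega>) \<in> borel_measurable M"
      unfolding cliquet_payoff_def sum_shift
      by (intro borel_measurable_add borel_measurable_times borel_measurable_max borel_measurable_const
          borel_measurable_sum borel_measurable_min measurable_period_return) auto
    show "(\<lambda>\<omega>. K + K * (g + ?G \<omega>)) \<in> borel_measurable M"
      using borel_measurable_integrable[OF int] by measurable
    show "AE \<omega> in M. cliquet_payoff W N Y S0 \<gamma> s t n K g c \<omega> = K + K * (g + ?G \<omega>)"
      using AE_period_return[of s]
    proof eventually_elim
      case (elim \<omega>)
      then have "(\<Sum>k=1..n. min c (period_return W N Y S0 \<gamma> s t k \<omega>)) = (\<Sum>i<n. capped_growth i s \<omega>) - real n"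
        unfolding sum_shift by (simp add: sum_subtractf)
      then show ?case
        by (simp add: cliquet_payoff_def max_def)
    qed
  qed
  also have "\<dots> = K + K * (g + expectation ?G)"
    using int by (simp add: prob_space)
  finally show ?thesis
    by (simp add: cliquet_price_def)
qed

text \<open>Almost surely \<open>cliquet_Z\<close> of period \<open>Suc i\<close>, but built from
  \<open>capped_growth\<close>, whose independence and law are at hand.\<close>

definition norm_return :: "nat \<Rightarrow> real \<Rightarrow> 'a \<Rightarrow> real" where
  "norm_return i s \<omega> = capped_growth i s \<omega> - (1 + g / real n)"

lemma measurable_norm_return [measurable]: "i < n \<Longrightarrow> random_variable borel (norm_return i s)"
  unfolding norm_return_def[abs_def] by measurable

text \<open>The centring contributes the leading phase, the layer cake the rest. The right-hand side
  is free of \<open>i\<close>, so all periods share one characteristic function.\<close>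

lemma char_norm_return:
  assumes i: "i < n" and s: "0 < s"
  shows "char (distr M borel (norm_return i s)) x = iexp (- x * (1 + g / real n)) *
    (iexp (x * (1 + c)) - \<i> * complex_of_real x *
      (CLBINT w:{0<..1 + c}. iexp (x * w) * complex_of_real (jump_diffusion_cdf lam \<tau> \<gamma> \<mu> \<delta> s w)))"
proof -
  have "char (distr M borel (norm_return i s)) x = expectation (\<lambda>\<omega>. iexp (x * norm_return i s \<omega>))"
    using i unfolding char_def by (subst integral_distr) auto
  also have "\<dots> = expectation (\<lambda>\<omega>. iexp (- x * (1 + g / real n)) * iexp (x * capped_growth i s \<omega>))"
    by (intro Bochner_Integration.integral_cong refl)
      (simp add: norm_return_def algebra_simps flip: exp_add)
  also have "\<dots> = iexp (- x * (1 + g / real n)) * expectation (\<lambda>\<omega>. iexp (x * capped_growth i s \<omega>))"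
    by simp
  also have "expectation (\<lambda>\<omega>. iexp (x * capped_growth i s \<omega>)) = iexp (x * (1 + c)) - \<i> * complex_of_real x *
      (CLBINT w:{0<..1 + c}. iexp (x * w) * complex_of_real (\<P>(\<omega> in M. capped_growth i s \<omega> \<le> w)))"
    using i by (intro expectation_iexp_layer_cake capped_growth_range) auto
  also have "(CLBINT w:{0<..1 + c}. iexp (x * w) * complex_of_real (\<P>(\<omega> in M. capped_growth i s \<omega> \<le> w))) =
      (CLBINT w:{0<..1 + c}. iexp (x * w) * complex_of_real (jump_diffusion_cdf lam \<tau> \<gamma> \<mu> \<delta> s w))"
    unfolding set_lebesgue_integral_def
  proof (rule integral_cong_AE)
    have [measurable]: "(\<lambda>w. \<P>(\<omega> in M. capped_growth i s \<omega> \<le> w)) \<in> borel_measurable borel"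
      using i by (intro borel_measurable_mono monoI finite_measure_mono) auto
    show "(\<lambda>w. indicat_real {0<..1 + c} w *\<^sub>R (iexp (x * w) *
        complex_of_real (\<P>(\<omega> in M. capped_growth i s \<omega> \<le> w)))) \<in> borel_measurable lborel"
      "(\<lambda>w. indicat_real {0<..1 + c} w *\<^sub>R (iexp (x * w) *
        complex_of_real (jump_diffusion_cdf lam \<tau> \<gamma> \<mu> \<delta> s w))) \<in> borel_measurable lborel"
      by measurable
    show "AE w in lborel. indicat_real {0<..1 + c} w *\<^sub>R (iexp (x * w) *
        complex_of_real (\<P>(\<omega> in M. capped_growth i s \<omega> \<le> w))) =
        indicat_real {0<..1 + c} w *\<^sub>R (iexp (x * w) *
        complex_of_real (jump_diffusion_cdf lam \<tau> \<gamma> \<mu> \<delta> s w))"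
      using AE_lborel_singleton[of "1 + c"]
      by eventually_elim (use capped_growth_cdf[OF i s] in \<open>auto simp: indicator_def\<close>)
  qed
  finally show ?thesis .
qed

lemma char_cliquet_Z:
  assumes s: "0 < s"
  shows "char (distr M borel (cliquet_Z W N Y S0 \<gamma> s t n g c 1)) = char (distr M borel (norm_return 0 s))"
proof -
  have n: "0 < n"
    using pos by simp
  have "distr M borel (cliquet_Z W N Y S0 \<gamma> s t n g c 1) = distr M borel (norm_return 0 s)"
  proof (rule distr_cong_AE)
    show "AE \<omega> in M. cliquet_Z W N Y S0 \<gamma> s t n g c 1 \<omega> = norm_return 0 s \<omega>"
      using AE_period_return[of s]
      by eventually_elim (use n in \<open>auto simp: cliquet_Z_def norm_return_def\<close>)
    show "random_variable borel (cliquet_Z W N Y S0 \<gamma> s t n g c 1)"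
      using measurable_period_return[OF n, of s] unfolding cliquet_Z_def[abs_def] by simp
    show "random_variable borel (norm_return 0 s)"
      using n by simp
  qed auto
  then show ?thesis
    by simp
qed

text \<open>The variable whose sign matters once period \<open>k\<close> is left out. Spreading
  \<open>- n - g\<close> evenly over the periods rewrites it as \<open>w - 1 - g / n\<close> plus
  \<open>n - 1\<close> variables \<open>norm_return\<close>; this explains the centring of Z by
  \<open>g / n\<close>.\<close>

definition shifted_sum :: "nat \<Rightarrow> real \<Rightarrow> real \<Rightarrow> 'a \<Rightarrow> real" where
  "shifted_sum k s w \<omega> = - real n - g + (\<Sum>i\<in>{..<n} - {k}. capped_growth i s \<omega>) + w"

lemma measurable_shifted_sum [measurable]: "random_variable borel (shifted_sum k s w)"
  unfolding shifted_sum_def[abs_def] by (intro borel_measurable_add borel_measurable_sum) auto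

lemma shifted_sum_bound:
  "\<bar>shifted_sum k s w \<omega>\<bar> \<le> real n + \<bar>g\<bar> + (\<Sum>i\<in>{..<n} - {k}. 1 + c) + \<bar>w\<bar>"
proof -
  have "\<bar>\<Sum>i\<in>{..<n} - {k}. capped_growth i s \<omega>\<bar> \<le> (\<Sum>i\<in>{..<n} - {k}. 1 + c)"
    using capped_growth_range by (intro order_trans[OF sum_abs sum_mono]) auto
  then show ?thesis
    unfolding shifted_sum_def by linarith
qed

lemma char_shifted_sum:
  assumes k: "k < n" and s: "0 < s"
  shows "char (distr M borel (shifted_sum k s w)) x =
    iexp (x * (w - 1 - g / real n)) * char (distr M borel (norm_return 0 s)) x ^ (n - 1)"
proof -
  have n: "0 < n"
    using pos by simp
  have indep: "indep_vars (\<lambda>_. borel) (\<lambda>i. norm_return i s) ({..<n} - {k})"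
    unfolding norm_return_def[abs_def]
    by (rule indep_vars_compose2[OF indep_vars_subset[OF capped_growth_indep[of "\<lambda>_. s"]]]) (use s in auto)
  have card: "real (card ({..<n} - {k})) = real n - 1"
    using k by (simp add: of_nat_diff)
  have eq: "shifted_sum k s w \<omega> = (w - 1 - g / real n) + (\<Sum>i\<in>{..<n} - {k}. norm_return i s \<omega>)" for \<omega>
    using n unfolding shifted_sum_def norm_return_def sum_subtractf sum_constant card
    by (simp add: field_simps)
  have iexp_add: "iexp (x * (u + v)) = iexp (x * u) * iexp (x * v)" for u v :: real
    by (simp add: algebra_simps flip: exp_add)
  have "char (distr M borel (shifted_sum k s w)) x = expectation (\<lambda>\<omega>. iexp (x * shifted_sum k s w \<omega>))"
    unfolding char_def by (subst integral_distr) auto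
  also have "\<dots> = expectation (\<lambda>\<omega>. iexp (x * (w - 1 - g / real n)) *
      iexp (x * (\<Sum>i\<in>{..<n} - {k}. norm_return i s \<omega>)))"
    unfolding eq iexp_add ..
  also have "\<dots> = iexp (x * (w - 1 - g / real n)) *
      char (distr M borel (\<lambda>\<omega>. \<Sum>i\<in>{..<n} - {k}. norm_return i s \<omega>)) x"
    unfolding char_def by (subst integral_distr) auto
  also have "char (distr M borel (\<lambda>\<omega>. \<Sum>i\<in>{..<n} - {k}. norm_return i s \<omega>)) x =
      (\<Prod>i\<in>{..<n} - {k}. char (distr M borel (norm_return i s)) x)"
    by (rule char_distr_sum[OF indep])
  also have "\<dots> = (\<Prod>i\<in>{..<n} - {k}. char (distr M borel (norm_return 0 s)) x)"
    using n s by (intro prod.cong refl) (simp add: char_norm_return)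
  also have "\<dots> = char (distr M borel (norm_return 0 s)) x ^ (n - 1)"
    using k by simp
  finally show ?thesis .
qed

section \<open>From the inversion integral to probabilities\<close>

lemma inversion_integrand_eq:
  assumes "k < n" "0 < s"
  shows "inversion_integrand (char (distr M borel (norm_return 0 s))) n g w =
    (\<lambda>x. Re (\<i> * char (distr M borel (shifted_sum k s w)) x) / x)"
  by (simp only: inversion_integrand_def[abs_def] char_shifted_sum[OF assms] mult.assoc)

lemma inversion_integrable:
  assumes "0 < s"
  shows "inversion_integrand (char (distr M borel (norm_return 0 s))) n g w integrable_on {0<..}"
proof -
  have "0 < n"
    using pos by simp
  from inversion_integrand_eq[OF this assms] show ?thesis
    using gil_pelaez_inversion(1)[OF measurable_shifted_sum shifted_sum_bound] by simp
qed

text \<open>The omitted period does not appear: by \<open>char_shifted_sum\<close> the integral is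
  the same for all of them, which collapses the sum over periods into the factor
  \<open>n\<close>.\<close>

definition inverted :: "real \<Rightarrow> real \<Rightarrow> real" where
  "inverted s w = 1 / 2 - 1 / pi * integral {0<..}
     (inversion_integrand (char (distr M borel (norm_return 0 s))) n g w)"

lemma inverted_eq:
  assumes "k < n" "0 < s"
  shows "inverted s w = expectation (\<lambda>\<omega>. (1 + sgn (shifted_sum k s w \<omega>)) / 2)"
  unfolding inverted_def inversion_integrand_eq[OF assms]
  by (rule gil_pelaez_inversion(2)[OF measurable_shifted_sum shifted_sum_bound])

lemma integrable_half_sgn:
  fixes X :: "'a \<Rightarrow> real"
  assumes [measurable]: "random_variable borel X"
  shows "integrable M (\<lambda>\<omega>. (1 + sgn (X \<omega>)) / 2)"
  by (rule integrable_const_bound[of _ 1]) (auto simp: sgn_if intro!: AE_I2)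

text \<open>Read off from the probabilistic form in \<open>inverted_eq\<close>; the oscillatory
  integral itself would hardly reveal it.\<close>

lemma inverted_bounds:
  assumes "0 < s"
  shows "0 \<le> inverted s w" "inverted s w \<le> 1"
proof -
  have n: "0 < n"
    using pos by simp
  show "0 \<le> inverted s w"
    unfolding inverted_eq[OF n assms] by (intro Bochner_Integration.integral_nonneg) (auto simp: sgn_if)
  have "expectation (\<lambda>\<omega>. (1 + sgn (shifted_sum 0 s w \<omega>)) / 2) \<le> expectation (\<lambda>\<omega>. 1)"
    by (intro integral_mono integrable_half_sgn) (auto simp: sgn_if)
  then show "inverted s w \<le> 1"
    by (simp add: inverted_eq[OF n assms] prob_space)
qed

text \<open>By \<open>inverted_eq\<close> the function is monotone in \<open>w\<close>, which
  bypasses measurability of a gauge integral in a parameter.\<close>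

lemma measurable_inverted: "0 < s \<Longrightarrow> inverted s \<in> borel_measurable borel"
proof (rule borel_measurable_mono, rule monoI)
  fix v w :: real assume "v \<le> w" "0 < s"
  have "0 < n"
    using pos by simp
  show "inverted s v \<le> inverted s w"
    unfolding inverted_eq[OF \<open>0 < n\<close> \<open>0 < s\<close>] using \<open>v \<le> w\<close>
    by (intro integral_mono integrable_half_sgn) (auto simp: sgn_if shifted_sum_def)
qed

text \<open>The two sides differ by half the probability that \<open>shifted_sum\<close> is 0, which
  is null for almost every \<open>w\<close>.\<close>

lemma AE_inverted:
  assumes "k < n" "0 < s"
  shows "AE w in lborel. inverted s w = \<P>(\<omega> in M. 0 < shifted_sum k s w \<omega>)"
proof -
  have shift: "shifted_sum k s 0 \<omega> + w = shifted_sum k s w \<omega>" for w \<omega>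
    by (simp add: shifted_sum_def)
  show ?thesis
    using AE_prob_eq_0[OF measurable_shifted_sum[of k s 0]] unfolding shift
  proof eventually_elim
    case (elim w)
    have "inverted s w = expectation (\<lambda>\<omega>. (1 + sgn (shifted_sum k s w \<omega>)) / 2)"
      by (rule inverted_eq[OF assms])
    also have "\<dots> = expectation (indicator {\<omega> \<in> space M. 0 < shifted_sum k s w \<omega>})"
      by (rule integral_cong_AE) (use elim in \<open>auto simp: sgn_if indicator_def elim!: AE_mp intro!: AE_I2\<close>)
    finally show ?case
      by simp
  qed
qed

text \<open>\<open>pos_part_sum_has_derivative\<close> with \<open>a = - n - g\<close> and
  \<open>L = 1 + c\<close>; the Lipschitz constant \<open>2 / \<sigma>\<close> is that of
  \<open>jump_diffusion_cdf_quotient_bound\<close>.\<close>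

lemma price_has_derivative:
  assumes \<sigma>: "0 < \<sigma>"
  shows "((\<lambda>s. cliquet_price M W N Y S0 r T \<gamma> s t n K g c) has_real_derivative
    - (real n * K * exp (- r * T) *
      (LBINT w:{0<..1 + c}. jump_diffusion_cdf_deriv lam \<tau> \<gamma> \<mu> \<delta> \<sigma> w * inverted \<sigma> w))) (at \<sigma>)"
proof -
  let ?F' = "jump_diffusion_cdf_deriv lam \<tau> \<gamma> \<mu> \<delta> \<sigma>"
  have "((\<lambda>s. expectation (\<lambda>\<omega>. max 0 (- real n - g + (\<Sum>i<n. capped_growth i s \<omega>)))) has_real_derivative
      - (\<Sum>k<n. LBINT w:{0<..1 + c}. ?F' w *
        \<P>(\<omega> in M. 0 < - real n - g + (\<Sum>i\<in>{..<n} - {k}. capped_growth i \<sigma> \<omega>) + w))) (at \<sigma>)"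
    using \<sigma> cap pos
    by (intro pos_part_sum_has_derivative[where F = "jump_diffusion_cdf lam \<tau> \<gamma> \<mu> \<delta>" and C = "2 / \<sigma>"]
        capped_growth_range capped_growth_isCont capped_growth_indep capped_growth_cdf
        jump_diffusion_cdf_abs_le_1 jump_diffusion_cdf_has_derivative jump_diffusion_cdf_quotient_bound
        measurable_jump_diffusion_cdf measurable_jump_diffusion_cdf_deriv) auto
  also have "(\<Sum>k<n. LBINT w:{0<..1 + c}. ?F' w *
        \<P>(\<omega> in M. 0 < - real n - g + (\<Sum>i\<in>{..<n} - {k}. capped_growth i \<sigma> \<omega>) + w)) =
      (\<Sum>k<n. LBINT w:{0<..1 + c}. ?F' w * inverted \<sigma> w)"
    unfolding shifted_sum_def[symmetric] set_lebesgue_integral_def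
  proof (intro sum.cong refl integral_cong_AE)
    fix k assume k: "k \<in> {..<n}"
    have [measurable]: "inverted \<sigma> \<in> borel_measurable borel"
      by (rule measurable_inverted[OF \<sigma>])
    have [measurable]: "(\<lambda>w. \<P>(\<omega> in M. 0 < shifted_sum k \<sigma> w \<omega>)) \<in> borel_measurable borel"
      by (intro borel_measurable_mono monoI finite_measure_mono) (auto simp: shifted_sum_def)
    show "(\<lambda>w. indicat_real {0<..1 + c} w *\<^sub>R (?F' w * \<P>(\<omega> in M. 0 < shifted_sum k \<sigma> w \<omega>))) \<in> borel_measurable lborel"
      "(\<lambda>w. indicat_real {0<..1 + c} w *\<^sub>R (?F' w * inverted \<sigma> w)) \<in> borel_measurable lborel"
      by measurable
    show "AE w in lborel. indicat_real {0<..1 + c} w *\<^sub>R (?F' w * \<P>(\<omega> in M. 0 < shifted_sum k \<sigma> w \<omega>)) =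
        indicat_real {0<..1 + c} w *\<^sub>R (?F' w * inverted \<sigma> w)"
      using AE_inverted[of k \<sigma>] k \<sigma> by auto
  qed
  finally have "((\<lambda>s. exp (- r * T) * (K + K * (g +
      expectation (\<lambda>\<omega>. max 0 (- real n - g + (\<Sum>i<n. capped_growth i s \<omega>)))))) has_real_derivative
      exp (- r * T) * (K * - (\<Sum>k<n. LBINT w:{0<..1 + c}. ?F' w * inverted \<sigma> w))) (at \<sigma>)"
    by (auto intro!: derivative_eq_intros)
  then show ?thesis
    unfolding cliquet_price_eq by (simp add: mult_ac)
qed

end


section \<open>Assembly of the Vega representation\<close>

theorem proposition4p2:
  fixes M :: "'a measure"
    and W :: "real \<Rightarrow> 'a \<Rightarrow> real" and N :: "real \<Rightarrow> 'a \<Rightarrow> nat" and Y :: "nat \<Rightarrow> 'a \<Rightarrow> real"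
    and S0 r lam \<mu> \<delta> \<sigma> \<gamma> \<eta> T \<tau> K g c :: real
    and t :: "nat \<Rightarrow> real" and n :: nat
    and \<phi>Z :: "real \<Rightarrow> complex"
  assumes "prob_space M"
    and "std_brownian_motion M T W"
    and "poisson_process M T lam N"
    and "\<And>j. j \<ge> 1 \<Longrightarrow> distributed M lborel (Y j) (normal_density \<mu> \<delta>)"
    and "independent_drivers M T W N Y"
    and "S0 > 0" "r > 0" "lam > 0" "\<delta> > 0" "\<sigma> > 0" "c \<ge> 0" "n \<ge> 1"
    and "\<eta> = r - lam * (LINT \<omega>|M. exp (Y 1 \<omega>) - 1)"
    and "\<gamma> = \<eta> - \<sigma>\<^sup>2 / 2"
    and "t 0 > 0" "\<tau> > 0" "\<And>k. 1 \<le> k \<Longrightarrow> k \<le> n \<Longrightarrow> t k - t (k - 1) = \<tau>" "t n \<le> T"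
    and phi: "\<phi>Z = char (distr M borel (cliquet_Z W N Y S0 \<gamma> \<sigma> t n g c 1))"
  shows "(\<forall>m x. set_integrable lborel {0<..1 + c}
        (\<lambda>w. iexp (x * w) * complex_of_real (cdf std_normal_distribution (std_arg \<tau> \<gamma> \<sigma> \<mu> \<delta> m w)))) \<and>
    (\<forall>x. summable (\<lambda>m. complex_of_real ((lam * \<tau>) ^ m / fact m) *
        (CLINT w:{0<..1 + c}|lborel.
           iexp (x * w) * complex_of_real (cdf std_normal_distribution (std_arg \<tau> \<gamma> \<sigma> \<mu> \<delta> m w))))) \<and>
    (\<forall>w\<in>{0<..1 + c}. inversion_integrand \<phi>Z n g w integrable_on {0<..}) \<and>
    (\<forall>m. set_integrable lborel {0<..1 + c} (\<lambda>w. cliquet_Psi \<tau> \<gamma> \<sigma> \<mu> \<delta> m w *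
        (1 / 2 - 1 / pi * integral {0<..} (inversion_integrand \<phi>Z n g w)))) \<and>
    (summable (\<lambda>m. (lam * \<tau>) ^ m / fact m *
        (LINT w:{0<..1 + c}|lborel. cliquet_Psi \<tau> \<gamma> \<sigma> \<mu> \<delta> m w *
           (1 / 2 - 1 / pi * integral {0<..} (inversion_integrand \<phi>Z n g w))))) \<and>
    (\<forall>x. \<phi>Z x = iexp (- x * (1 + g / real n)) *
        (iexp (x * (1 + c)) - \<i> * complex_of_real x * complex_of_real (exp (- lam * \<tau>)) *
          (\<Sum>m. complex_of_real ((lam * \<tau>) ^ m / fact m) *
            (CLINT w:{0<..1 + c}|lborel. iexp (x * w) *
               complex_of_real (cdf std_normal_distribution (std_arg \<tau> \<gamma> \<sigma> \<mu> \<delta> m w)))))) \<and>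
    (((\<lambda>s. cliquet_price M W N Y S0 r T \<gamma> s t n K g c) has_real_derivative
        real n * \<tau> * \<sigma> * K * exp (- r * T - lam * \<tau>) *
        (\<Sum>m. (lam * \<tau>) ^ m / fact m *
          (LINT w:{0<..1 + c}|lborel. cliquet_Psi \<tau> \<gamma> \<sigma> \<mu> \<delta> m w *
             (1 / 2 - 1 / pi * integral {0<..} (inversion_integrand \<phi>Z n g w))))) (at \<sigma>))"
proof -
  have step: "t (Suc i) = t i + \<tau>" if "i < n" for i
    using assms(17)[of "Suc i"] that by (simp add: algebra_simps)
  interpret cliquet_market M W N Y T lam \<mu> \<delta> \<tau> t n S0 \<gamma> c g
    by (intro cliquet_market.intro jump_drivers.intro jump_drivers_axioms.intro
        cliquet_market_axioms.intro)
      (fact assms step order.strict_implies_order[OF \<open>t 0 > 0\<close>])+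
  note \<sigma> = \<open>\<sigma> > 0\<close>
  have \<phi>Z: "\<phi>Z = char (distr M borel (norm_return 0 \<sigma>))"
    using phi char_cliquet_Z[OF \<sigma>] by simp
  have n: "0 < n"
    using \<open>n \<ge> 1\<close> by simp
  have bracket: "1 / 2 - 1 / pi * integral {0<..} (inversion_integrand \<phi>Z n g w) = inverted \<sigma> w" for w
    by (simp add: \<phi>Z inverted_def)
  have [measurable]: "inverted \<sigma> \<in> borel_measurable borel"
    by (rule measurable_inverted[OF \<sigma>])
  let ?p = "\<lambda>m. (lam * \<tau>) ^ m / fact m"
  have p: "summable ?p" "\<And>m. 0 \<le> ?p m"
    using poisson_weights[of "lam * \<tau>"] pos by auto
  let ?f = "\<lambda>x m w. iexp (x * w) * complex_of_real (cdf std_normal_distribution (std_arg \<tau> \<gamma> \<sigma> \<mu> \<delta> m w))"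
  have f_meas: "?f x m \<in> borel_measurable borel" for x m
    by measurable
  have f_bound: "norm (?f x m w) \<le> 1" for x m w
    using cdf_std_normal_bounds by (simp add: norm_mult)
  let ?h = "\<lambda>m w. cliquet_Psi \<tau> \<gamma> \<sigma> \<mu> \<delta> m w * inverted \<sigma> w"
  have h_meas: "?h m \<in> borel_measurable borel" for m
    by measurable
  have h_bound: "norm (?h m w) \<le> 1 / (\<sigma>\<^sup>2 * \<tau>)" for m w
  proof -
    have "\<bar>cliquet_Psi \<tau> \<gamma> \<sigma> \<mu> \<delta> m w\<bar> * \<bar>inverted \<sigma> w\<bar> \<le> 1 / (\<sigma>\<^sup>2 * \<tau>) * 1"
      using inverted_bounds[OF \<sigma>, of w] pos \<sigma> by (intro mult_mono cliquet_Psi_bound) auto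
    then show ?thesis
      by (simp add: abs_mult)
  qed
  have L: "0 \<le> 1 + c"
    using cap by simp
  \<comment> \<open>One interchange serves twice: for the complex series in the characteristic
    function with bound 1, and for the real Vega series with the bound from
    \<open>cliquet_Psi_bound\<close>.\<close>
  note f_series = set_integral_weighted_series[OF p f_meas f_bound L]
  note h_series = set_integral_weighted_series[OF p h_meas h_bound L, simplified of_real_eq_id id_apply]
  show ?thesis
    unfolding bracket
  proof (intro conjI allI ballI)
    show "set_integrable lborel {0<..1 + c} (?f x m)" for m x
      by (rule set_integrable_bounded[OF f_meas f_bound])
    show "summable (\<lambda>m. complex_of_real (?p m) * (CLINT w:{0<..1 + c}|lborel. ?f x m w))" for x
      by (rule f_series(1))
    show "inversion_integrand \<phi>Z n g w integrable_on {0<..}" for w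
      unfolding \<phi>Z by (rule inversion_integrable[OF \<sigma>])
    show "set_integrable lborel {0<..1 + c} (?h m)" for m
      by (rule set_integrable_bounded[OF h_meas h_bound])
    show "summable (\<lambda>m. ?p m * (LINT w:{0<..1 + c}|lborel. ?h m w))"
      by (rule h_series(1))
    show "\<phi>Z x = iexp (- x * (1 + g / real n)) *
        (iexp (x * (1 + c)) - \<i> * complex_of_real x * complex_of_real (exp (- lam * \<tau>)) *
          (\<Sum>m. complex_of_real (?p m) * (CLINT w:{0<..1 + c}|lborel. ?f x m w)))" for x
    proof -
      have "iexp (x * w) * complex_of_real (jump_diffusion_cdf lam \<tau> \<gamma> \<mu> \<delta> \<sigma> w) =
          complex_of_real (exp (- lam * \<tau>)) * (\<Sum>m. complex_of_real (?p m) * ?f x m w)" for w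
      proof -
        let ?c = "\<lambda>m. cdf std_normal_distribution (std_arg \<tau> \<gamma> \<sigma> \<mu> \<delta> m w)"
        have "summable (\<lambda>m. ?p m * ?c m)"
          using summable_weighted[OF p, of ?c 1] cdf_std_normal_bounds by simp
        then have "(\<lambda>m. complex_of_real (?p m * ?c m)) sums complex_of_real (\<Sum>m. ?p m * ?c m)"
          by (intro sums_of_real summable_sums)
        then have "(\<lambda>m. iexp (x * w) * complex_of_real (?p m * ?c m)) sums
            (iexp (x * w) * complex_of_real (\<Sum>m. ?p m * ?c m))"
          by (rule sums_mult)
        then have "(\<Sum>m. complex_of_real (?p m) * ?f x m w) = iexp (x * w) * complex_of_real (\<Sum>m. ?p m * ?c m)"
          by (simp add: sums_iff mult_ac)
        then show ?thesis
          by (simp add: jump_diffusion_cdf_def)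
      qed
      then have "(CLBINT w:{0<..1 + c}. iexp (x * w) * complex_of_real (jump_diffusion_cdf lam \<tau> \<gamma> \<mu> \<delta> \<sigma> w)) =
          complex_of_real (exp (- lam * \<tau>)) * (CLBINT w:{0<..1 + c}. (\<Sum>m. complex_of_real (?p m) * ?f x m w))"
        by (simp only: set_integral_mult_right_zero)
      then show ?thesis
        unfolding \<phi>Z char_norm_return[OF n \<sigma>] f_series(2) by (simp only: mult.assoc)
    qed
    show "((\<lambda>s. cliquet_price M W N Y S0 r T \<gamma> s t n K g c) has_real_derivative
        real n * \<tau> * \<sigma> * K * exp (- r * T - lam * \<tau>) *
        (\<Sum>m. ?p m * (LINT w:{0<..1 + c}|lborel. ?h m w))) (at \<sigma>)"
    proof -
      have "jump_diffusion_cdf_deriv lam \<tau> \<gamma> \<mu> \<delta> \<sigma> w * inverted \<sigma> w =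
          - (exp (- lam * \<tau>) * \<sigma> * \<tau>) * (\<Sum>m. ?p m * ?h m w)" for w
      proof -
        let ?c = "\<lambda>m. cliquet_Psi \<tau> \<gamma> \<sigma> \<mu> \<delta> m w"
        have "summable (\<lambda>m. ?p m * ?c m)"
          using summable_weighted[OF p, of ?c "1 / (\<sigma>\<^sup>2 * \<tau>)"] cliquet_Psi_bound[OF \<sigma>] pos by simp
        then have sums: "(\<lambda>m. ?p m * ?c m) sums (\<Sum>m. ?p m * ?c m)"
          by (rule summable_sums)
        have "(\<Sum>m. ?p m * ?h m w) = (\<Sum>m. ?p m * ?c m) * inverted \<sigma> w"
          using sums_mult2[OF sums, of "inverted \<sigma> w"] by (simp add: sums_iff mult_ac)
        moreover have "(\<Sum>m. ?p m * - (\<sigma> * \<tau> * ?c m)) = - (\<sigma> * \<tau>) * (\<Sum>m. ?p m * ?c m)"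
          using sums_mult[OF sums, of "- (\<sigma> * \<tau>)"] by (simp add: sums_iff mult_ac)
        ultimately show ?thesis
          by (simp add: jump_diffusion_cdf_deriv_def)
      qed
      then have "(LBINT w:{0<..1 + c}. jump_diffusion_cdf_deriv lam \<tau> \<gamma> \<mu> \<delta> \<sigma> w * inverted \<sigma> w) =
          - (exp (- lam * \<tau>) * \<sigma> * \<tau>) * (\<Sum>m. ?p m * (LINT w:{0<..1 + c}|lborel. ?h m w))"
        by (simp only: set_integral_mult_right_zero h_series(2))
      moreover have "exp (- r * T - lam * \<tau>) = exp (- r * T) * exp (- lam * \<tau>)"
        by (simp flip: exp_add)
      \<comment> \<open>The minus sign of the layer-cake formula cancels against that of the
        derivative of the distribution function.\<close>
      moreover have "- (real n * K * R * (- (E * \<sigma> * \<tau>) * S)) = real n * \<tau> * \<sigma> * K * (R * E) * S" for R E S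
        by simp
      ultimately have "- (real n * K * exp (- r * T) *
          (LBINT w:{0<..1 + c}. jump_diffusion_cdf_deriv lam \<tau> \<gamma> \<mu> \<delta> \<sigma> w * inverted \<sigma> w)) =
          real n * \<tau> * \<sigma> * K * exp (- r * T - lam * \<tau>) *
          (\<Sum>m. ?p m * (LINT w:{0<..1 + c}|lborel. ?h m w))"
        by (simp only:)
      with price_has_derivative[OF \<sigma>, of r K] show ?thesis
        by (simp only:)
    qed
  qed
qed

end
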